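(* Let $G$ be a finite abelian subgroup of $\operatorname{SL}(n,\mathbb{C})$, taken to be diagonal. Suppose that there is a Hilbert basis resolution $\phi:X_\Xi\to\mathbb{C}^n/G=U_{\sigma,N}$, and for each $\hat g\in\hat G\cap \mathbf{Hlb}_N(\sigma)$ denote by $E_g$ the irreducible component of the exceptional set of $\phi$ corresponding to the ray $\rho_g:=\operatorname{Cone}(\hat g)$. If $\operatorname{age}(g)=1$, then $E_g$ is a deformation retract of the toric variety $X_{\Xi_g}$, where $\Xi_g$ is the fan consisting of all the faces of the cones in the set $$\Xi_g(n):=\{\eta\in\Xi(n)\mid\rho_g\preceq\eta\}.$$ In particular, $X_{\Xi_g}$ is open in $X_\Xi$.
   Context: All varieties are over $\mathbb{C}$. A finite abelian subgroup $G\subset \operatorname{SL}(n,\mathbb{C})$ is conjugate to a diagonal one, so $G$ is assumed diagonal. Let $r$ be the order of $G$ and $\epsilon_r$ a fixed primitive $r$-th root of unity. Each $g\in G$ is uniquely $g=\operatorname{diag}(\epsilon_r^{a_1},\dots,\epsilon_r^{a_n})$ with integers $0\le a_i\le r-1$. Its fractional expression is $\hat g=\frac1r(a_1,\dots,a_n)\in\mathbb{Q}^n$, its age is $\operatorname{age}(g)=\operatorname{age}(\hat g)=\frac1r(a_1+\dots+a_n)$, an integer, and $\hat G=\{\hat g\mid g\in G\}$. Let $N=\mathbb{Z}^n+\sum_{g\in G}\mathbb{Z}\hat g\subset\mathbb{R}^n=N_{\mathbb{R}}$, a lattice, and $\sigma=\operatorname{Cone}(e_1,\dots,e_n)$ with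 $e_i$ the standard basis of $\mathbb{R}^n$. Then $\mathbb{C}^n/G$ is the affine toric variety $U_{\sigma,N}$ of the cone $\sigma$ with respect to $N$. $\mathbf{Hlb}_N(\sigma)$ is the Hilbert basis of $\sigma\cap N$, i.e. the unique minimal system of generators of the semigroup $\sigma\cap N$; it consists of the irreducible elements, the nonzero $u\in\sigma\cap N$ such that $u=u_1+u_2$ with $u_1,u_2\in\sigma\cap N$ implies $u_1=0$ or $u_2=0$. A fan $\Xi$ in $N_{\mathbb{R}}$ refining $\sigma$ (i.e. with support $\sigma$) induces a proper birational toric morphism $\phi:X_\Xi\to U_{\sigma,N}$; this is a Hilbert basis resolution if $\Xi$ is smooth (every cone is generated by part of a $\mathbb{Z}$-basis of $N$) and the set of primitive ray generators of $\Xi$ is exactly $\mathbf{Hlb}_N(\sigma)$. $\Xi(m)$ denotes the set of $m$-dimensional cones of $\Xi$, and $\tau\preceq\eta$ means that $\tau$ is a face of $\eta$. $E_g=V(\rho_g)\subset X_\Xi$ is the closure of the torus orbit corresponding to the ray $\rho_g$. $X_{\Xi_g}$ is the toric variety of $\Xi_g$ with respect to $N$, regarded as a subvariety of $X_\Xi$ via $\Xi_g\subset\Xi$. "Deformation retract" is meant for the classical (complex) topology. *)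

theory Defs
  imports "HOL-Analysis.Analysis" "HOL-Algebra.Group"
begin

section \<open>Diagonal subgroups of the special linear group\<close>

definition SL_group :: "(complex ^ 'n ^ 'n) monoid" where
  "SL_group = \<lparr>carrier = {A. det A = 1}, mult = (**), one = mat 1\<rparr>"

definition diagonal_matrix :: "complex ^ 'n ^ 'n \<Rightarrow> bool" where
  "diagonal_matrix A \<longleftrightarrow> (\<forall>i j. i \<noteq> j \<longrightarrow> A $ i $ j = 0)"

definition primitive_root_of_unity :: "nat \<Rightarrow> complex \<Rightarrow> bool" where
  "primitive_root_of_unity r \<epsilon> \<longleftrightarrow> r > 0 \<and> \<epsilon> ^ r = 1 \<and> (\<forall>k. 0 < k \<and> k < r \<longrightarrow> \<epsilon> ^ k \<noteq> 1)"

definition frac_expr :: "nat \<Rightarrow> complex \<Rightarrow> complex ^ 'n ^ 'n \<Rightarrow> real ^ 'n" where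
  "frac_expr r \<epsilon> g = (\<chi> i. real (THE a. a < r \<and> g $ i $ i = \<epsilon> ^ a) / real r)"

definition age :: "real ^ 'n \<Rightarrow> real" where
  "age v = (\<Sum>i\<in>UNIV. v $ i)"

text \<open>The lattice generated by the standard lattice and the fractional expressions of a finite
  group of matrices; the order of the group is also the order of the chosen root of unity.\<close>

definition quotient_lattice :: "complex \<Rightarrow> (complex ^ 'n ^ 'n) set \<Rightarrow> (real ^ 'n) set" where
  "quotient_lattice \<epsilon> G =
     {v + (\<Sum>g\<in>G. of_int (c g) *\<^sub>R frac_expr (card G) \<epsilon> g) | v c. \<forall>i. v $ i \<in> \<int>}"

definition standard_cone :: "(real ^ 'n) set" where
  "standard_cone = convex_cone hull (range (\<lambda>i. axis i 1))"


section \<open>Cones and fans\<close>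

text \<open>Lattices are full-rank subgroups of \<open>real ^ 'n\<close>.\<close>

definition lattice_basis :: "(real ^ 'n) set \<Rightarrow> (real ^ 'n) set \<Rightarrow> bool" where
  "lattice_basis N B \<longleftrightarrow>
     independent B \<and> N = {\<Sum>b\<in>B. of_int (c b) *\<^sub>R b | c :: real ^ 'n \<Rightarrow> int. True}"

definition rational_cone :: "(real ^ 'n) set \<Rightarrow> (real ^ 'n) set \<Rightarrow> bool" where
  "rational_cone N \<tau> \<longleftrightarrow>
     (\<exists>S. finite S \<and> S \<subseteq> N \<and> \<tau> = convex_cone hull S) \<and> \<tau> \<inter> uminus ` \<tau> = {0}"

text \<open>For a polyhedral cone, the nonempty faces in the sense of convex geometry are exactly its
  intersections with supporting hyperplanes through the origin.\<close>

definition cone_face :: "(real ^ 'n) set \<Rightarrow> (real ^ 'n) set \<Rightarrow> bool" where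
  "cone_face \<tau> \<eta> \<longleftrightarrow> \<tau> face_of \<eta> \<and> \<tau> \<noteq> {}"

definition fan :: "(real ^ 'n) set \<Rightarrow> (real ^ 'n) set set \<Rightarrow> bool" where
  "fan N \<Xi> \<longleftrightarrow>
     finite \<Xi> \<and>
     (\<forall>\<eta>\<in>\<Xi>. rational_cone N \<eta>) \<and>
     (\<forall>\<eta>\<in>\<Xi>. \<forall>\<tau>. cone_face \<tau> \<eta> \<longrightarrow> \<tau> \<in> \<Xi>) \<and>
     (\<forall>\<eta>\<in>\<Xi>. \<forall>\<eta>'\<in>\<Xi>. cone_face (\<eta> \<inter> \<eta>') \<eta> \<and> cone_face (\<eta> \<inter> \<eta>') \<eta>')"

definition cones_of_dim :: "(real ^ 'n) set set \<Rightarrow> nat \<Rightarrow> (real ^ 'n) set set" where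
  "cones_of_dim \<Xi> m = {\<eta> \<in> \<Xi>. dim \<eta> = m}"

definition smooth_fan :: "(real ^ 'n) set \<Rightarrow> (real ^ 'n) set set \<Rightarrow> bool" where
  "smooth_fan N \<Xi> \<longleftrightarrow>
     fan N \<Xi> \<and> (\<forall>\<eta>\<in>\<Xi>. \<exists>B S. lattice_basis N B \<and> S \<subseteq> B \<and> \<eta> = convex_cone hull S)"

definition primitive_ray_generators ::
    "(real ^ 'n) set \<Rightarrow> (real ^ 'n) set set \<Rightarrow> (real ^ 'n) set" where
  "primitive_ray_generators N \<Xi> =
     {u. \<exists>\<rho>\<in>cones_of_dim \<Xi> 1. \<rho> \<inter> N = range (\<lambda>k::nat. of_nat k *\<^sub>R u)}"

text \<open>The irreducible elements of an additive semigroup \<open>A\<close> of vectors.\<close>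

definition Hilbert_basis :: "(real ^ 'n) set \<Rightarrow> (real ^ 'n) set" where
  "Hilbert_basis A =
     {u \<in> A. u \<noteq> 0 \<and> (\<forall>u1\<in>A. \<forall>u2\<in>A. u = u1 + u2 \<longrightarrow> u1 = 0 \<or> u2 = 0)}"

text \<open>The condition on \<open>\<Xi>\<close> under which the toric morphism from its toric variety to the affine
  toric variety of \<open>\<sigma>\<close> is a Hilbert basis resolution.\<close>

definition Hilbert_basis_resolution ::
    "(real ^ 'n) set \<Rightarrow> (real ^ 'n) set \<Rightarrow> (real ^ 'n) set set \<Rightarrow> bool" where
  "Hilbert_basis_resolution N \<sigma> \<Xi> \<longleftrightarrow>
     smooth_fan N \<Xi> \<and> \<Union>\<Xi> = \<sigma> \<and> primitive_ray_generators N \<Xi> = Hilbert_basis (\<sigma> \<inter> N)"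

definition star_fan :: "(real ^ 'n) set set \<Rightarrow> (real ^ 'n) set \<Rightarrow> (real ^ 'n) set set" where
  "star_fan \<Xi> \<rho> = {\<tau>. \<exists>\<eta>\<in>cones_of_dim \<Xi> CARD('n). cone_face \<rho> \<eta> \<and> cone_face \<tau> \<eta>}"


section \<open>Affine toric varieties\<close>

text \<open>The dual lattice and the dual cone, both identified with subsets of \<open>real ^ 'n\<close> through the
  inner product.\<close>

definition dual_lattice :: "(real ^ 'n) set \<Rightarrow> (real ^ 'n) set" where
  "dual_lattice N = {m. \<forall>u\<in>N. m \<bullet> u \<in> \<int>}"

definition dual_cone :: "(real ^ 'n) set \<Rightarrow> (real ^ 'n) set" where
  "dual_cone \<tau> = {m. \<forall>u\<in>\<tau>. 0 \<le> m \<bullet> u}"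

definition cone_semigroup :: "(real ^ 'n) set \<Rightarrow> (real ^ 'n) set \<Rightarrow> (real ^ 'n) set" where
  "cone_semigroup N \<tau> = dual_cone \<tau> \<inter> dual_lattice N"

text \<open>The complex points of \<open>Spec \<complex>[S]\<close>, for \<open>S\<close> the semigroup of \<open>\<tau>\<close>, are the monoid
  homomorphisms from \<open>S\<close> to the multiplicative monoid of the complex numbers.\<close>

definition affine_points ::
    "(real ^ 'n) set \<Rightarrow> (real ^ 'n) set \<Rightarrow> (real ^ 'n \<Rightarrow> complex) set" where
  "affine_points N \<tau> =
     {\<gamma> \<in> extensional (cone_semigroup N \<tau>).
        \<gamma> 0 = 1 \<and>
        (\<forall>m\<in>cone_semigroup N \<tau>. \<forall>m'\<in>cone_semigroup N \<tau>. \<gamma> (m + m') = \<gamma> m * \<gamma> m')}"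

text \<open>The classical topology is that of pointwise convergence: a finite generating set of the
  semigroup embeds the affine toric variety as a closed subset of an affine space, and the values
  at all other elements are monomials in these coordinates.\<close>

definition affine_classical ::
    "(real ^ 'n) set \<Rightarrow> (real ^ 'n) set \<Rightarrow> (real ^ 'n \<Rightarrow> complex) topology" where
  "affine_classical N \<tau> =
     subtopology (product_topology (\<lambda>m. euclidean) (cone_semigroup N \<tau>)) (affine_points N \<tau>)"

text \<open>The Zariski topology is generated by the nonvanishing loci of the regular functions, that
  is, of the linear combinations of characters.\<close>

definition affine_Zariski ::
    "(real ^ 'n) set \<Rightarrow> (real ^ 'n) set \<Rightarrow> (real ^ 'n \<Rightarrow> complex) topology" where
  "affine_Zariski N \<tau> =
     topology_generated_by
       {{\<gamma> \<in> affine_points N \<tau>. (\<Sum>m\<in>F. c m * \<gamma> m) \<noteq> 0} | F c.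
          finite F \<and> F \<subseteq> cone_semigroup N \<tau>}"


section \<open>The toric variety of a fan\<close>

text \<open>Points of two affine charts are identified if they come from a point of the chart of a
  common face. For two cones \<open>\<tau>\<close>, \<open>\<tau>'\<close> of one fan this is the usual gluing along the chart of
  \<open>\<tau> \<inter> \<tau>'\<close>, as the common faces are the faces of that intersection. Since the relation does not
  mention the fan, the variety of a subfan is literally a subset of the variety of the fan. It is
  an equivalence relation without restriction to one fan: inside the chart of \<open>\<tau>\<close>, the charts of
  two faces meet in the chart of the intersection of the faces.\<close>

definition toric_glue :: "(real ^ 'n) set \<Rightarrow>
    (((real ^ 'n) set \<times> (real ^ 'n \<Rightarrow> complex)) \<times> ((real ^ 'n) set \<times> (real ^ 'n \<Rightarrow> complex))) set"
  where
  "toric_glue N =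
     {((\<tau>, \<gamma>), (\<tau>', \<gamma>')).
        rational_cone N \<tau> \<and> rational_cone N \<tau>' \<and>
        (\<exists>\<kappa>. cone_face \<kappa> \<tau> \<and> cone_face \<kappa> \<tau>' \<and>
          (\<exists>\<delta>\<in>affine_points N \<kappa>.
             \<gamma> = restrict \<delta> (cone_semigroup N \<tau>) \<and> \<gamma>' = restrict \<delta> (cone_semigroup N \<tau>')))}"

type_synonym 'n toric_point = "((real ^ 'n) set \<times> (real ^ 'n \<Rightarrow> complex)) set"

definition toric_point ::
    "(real ^ 'n) set \<Rightarrow> (real ^ 'n) set \<Rightarrow> (real ^ 'n \<Rightarrow> complex) \<Rightarrow> 'n toric_point" where
  "toric_point N \<tau> \<gamma> = toric_glue N `` {(\<tau>, \<gamma>)}"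

definition toric_points :: "(real ^ 'n) set \<Rightarrow> (real ^ 'n) set set \<Rightarrow> 'n toric_point set" where
  "toric_points N \<Xi> = (\<Union>\<tau>\<in>\<Xi>. toric_point N \<tau> ` affine_points N \<tau>)"

text \<open>The final topology with respect to the charts, each of them given the topology \<open>T \<tau>\<close>.\<close>

definition glued_topology ::
    "((real ^ 'n) set \<Rightarrow> (real ^ 'n \<Rightarrow> complex) topology) \<Rightarrow>
     (real ^ 'n) set \<Rightarrow> (real ^ 'n) set set \<Rightarrow> 'n toric_point topology" where
  "glued_topology T N \<Xi> =
     topology (\<lambda>U. U \<subseteq> toric_points N \<Xi> \<and>
                   (\<forall>\<tau>\<in>\<Xi>. openin (T \<tau>) {\<gamma> \<in> affine_points N \<tau>. toric_point N \<tau> \<gamma> \<in> U}))"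

lemma openin_glued_topology:
  "openin (glued_topology T N \<Xi>) U \<longleftrightarrow>
     U \<subseteq> toric_points N \<Xi> \<and>
     (\<forall>\<tau>\<in>\<Xi>. openin (T \<tau>) {\<gamma> \<in> affine_points N \<tau>. toric_point N \<tau> \<gamma> \<in> U})"
proof -
  let ?P = "\<lambda>\<tau> U. {\<gamma> \<in> affine_points N \<tau>. toric_point N \<tau> \<gamma> \<in> U}"
  have Int: "?P \<tau> (U \<inter> V) = ?P \<tau> U \<inter> ?P \<tau> V" for \<tau> U V
    by auto
  have Union: "?P \<tau> (\<Union>\<K>) = (\<Union>U\<in>\<K>. ?P \<tau> U)" for \<tau> \<K>
    by auto
  have "istopology (\<lambda>U. U \<subseteq> toric_points N \<Xi> \<and> (\<forall>\<tau>\<in>\<Xi>. openin (T \<tau>) (?P \<tau> U)))"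
    unfolding istopology_def Int Union by (blast intro: openin_Int openin_Union)
  then show ?thesis
    unfolding glued_topology_def by (simp add: topology_inverse')
qed

definition toric_variety ::
    "(real ^ 'n) set \<Rightarrow> (real ^ 'n) set set \<Rightarrow> 'n toric_point topology" where
  "toric_variety N \<Xi> = glued_topology (affine_classical N) N \<Xi>"

definition toric_Zariski ::
    "(real ^ 'n) set \<Rightarrow> (real ^ 'n) set set \<Rightarrow> 'n toric_point topology" where
  "toric_Zariski N \<Xi> = glued_topology (affine_Zariski N) N \<Xi>"

lemma topspace_affine_classical: "topspace (affine_classical N \<tau>) = affine_points N \<tau>"
  by (auto simp: affine_classical_def affine_points_def PiE_def)

lemma topspace_affine_Zariski: "topspace (affine_Zariski N \<tau>) = affine_points N \<tau>"
proof -
  let ?D = "\<lambda>F c. {\<gamma> \<in> affine_points N \<tau>. (\<Sum>m\<in>F. c m * \<gamma> m) \<noteq> 0}"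
  have "0 \<in> cone_semigroup N \<tau>"
    by (simp add: cone_semigroup_def dual_cone_def dual_lattice_def)
  moreover have "?D {0} (\<lambda>_. 1) = affine_points N \<tau>"
    by (auto simp: affine_points_def)
  ultimately have "\<exists>F c. affine_points N \<tau> = ?D F c \<and> finite F \<and> F \<subseteq> cone_semigroup N \<tau>"
    by (intro exI[of _ "{0}"] exI[of _ "\<lambda>_. 1"] conjI) (erule sym, simp_all)
  then have "affine_points N \<tau> \<in> {?D F c | F c. finite F \<and> F \<subseteq> cone_semigroup N \<tau>}"
    by (rule CollectI)
  then show ?thesis
    unfolding affine_Zariski_def topology_generated_by_topspace by blast
qed

lemma topspace_glued_topology:
  assumes "\<And>\<tau>. topspace (T \<tau>) = affine_points N \<tau>"
  shows "topspace (glued_topology T N \<Xi>) = toric_points N \<Xi>"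
proof
  show "topspace (glued_topology T N \<Xi>) \<subseteq> toric_points N \<Xi>"
    using openin_topspace[of "glued_topology T N \<Xi>"] unfolding openin_glued_topology by (rule conjunct1)
  have "openin (T \<tau>) {\<gamma> \<in> affine_points N \<tau>. toric_point N \<tau> \<gamma> \<in> toric_points N \<Xi>}"
    if "\<tau> \<in> \<Xi>" for \<tau>
  proof -
    have "{\<gamma> \<in> affine_points N \<tau>. toric_point N \<tau> \<gamma> \<in> toric_points N \<Xi>} = topspace (T \<tau>)"
      using that by (auto simp: toric_points_def assms)
    then show ?thesis
      by simp
  qed
  then have "openin (glued_topology T N \<Xi>) (toric_points N \<Xi>)"
    unfolding openin_glued_topology by simp
  then show "toric_points N \<Xi> \<subseteq> topspace (glued_topology T N \<Xi>)"
    by (rule openin_subset)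
qed

lemma topspace_toric_variety: "topspace (toric_variety N \<Xi>) = toric_points N \<Xi>"
  unfolding toric_variety_def by (rule topspace_glued_topology) (rule topspace_affine_classical)

lemma topspace_toric_Zariski: "topspace (toric_Zariski N \<Xi>) = toric_points N \<Xi>"
  unfolding toric_Zariski_def by (rule topspace_glued_topology) (rule topspace_affine_Zariski)


section \<open>Torus orbits\<close>

definition torus :: "(real ^ 'n) set \<Rightarrow> (real ^ 'n \<Rightarrow> complex) set" where
  "torus N =
     {t \<in> extensional (dual_lattice N).
        (\<forall>m\<in>dual_lattice N. t m \<noteq> 0) \<and>
        (\<forall>m\<in>dual_lattice N. \<forall>m'\<in>dual_lattice N. t (m + m') = t m * t m')}"

definition distinguished_point ::
    "(real ^ 'n) set \<Rightarrow> (real ^ 'n) set \<Rightarrow> (real ^ 'n \<Rightarrow> complex)" where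
  "distinguished_point N \<tau> =
     (\<lambda>m\<in>cone_semigroup N \<tau>. if \<forall>u\<in>\<tau>. m \<bullet> u = 0 then 1 else 0)"

definition torus_orbit :: "(real ^ 'n) set \<Rightarrow> (real ^ 'n) set \<Rightarrow> 'n toric_point set" where
  "torus_orbit N \<tau> =
     {toric_point N \<tau> (\<lambda>m\<in>cone_semigroup N \<tau>. t m * distinguished_point N \<tau> m) | t. t \<in> torus N}"

definition orbit_closure ::
    "(real ^ 'n) set \<Rightarrow> (real ^ 'n) set set \<Rightarrow> (real ^ 'n) set \<Rightarrow> 'n toric_point set" where
  "orbit_closure N \<Xi> \<tau> =
     Abstract_Topology.closure_of (toric_variety N \<Xi>) (torus_orbit N \<tau>)"


section \<open>Deformation retracts\<close>

text \<open>The homotopy fixes the subspace pointwise at all times.\<close>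

definition deformation_retract_of :: "'a set \<Rightarrow> 'a topology \<Rightarrow> bool" where
  "deformation_retract_of E X \<longleftrightarrow>
     E \<subseteq> topspace X \<and>
     (\<exists>r. homotopic_with (\<lambda>f. \<forall>x\<in>E. f x = x) X X id r \<and> r ` topspace X \<subseteq> E)"

end

theory Submission
  imports Defs
begin

text \<open>All maximal cones of the star of \<open>\<rho>\<close> contain the ray generator \<open>v\<close>, so the one-parameter
  subgroup \<open>s \<mapsto> (m \<mapsto> s ^ \<langle>m, v\<rangle>)\<close> acts on their charts by nonnegative powers of \<open>s\<close>, and the action
  extends continuously to \<open>s = 0\<close>. It contracts each chart onto the locus where the characters that are
  positive on \<open>v\<close> vanish, and it fixes this locus pointwise. Inside the whole variety this locus is
  closed, contains the orbit of \<open>\<rho>\<close>, and lies in its closure, since the vanishing coordinates other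
  than the one dual to \<open>v\<close> can be perturbed. It lies in the variety of the star because a fan with
  full-dimensional convex support is pure: its lower-dimensional cones are negligible. That \<open>v\<close> is
  one of the generators of every cone containing it follows from its irreducibility in the Hilbert basis.\<close>

section \<open>Smooth cones and their faces\<close>

text \<open>Points are classes of a relation over all rational cones, so every statement about a
  point has to be carried between representatives. The instrument is that the chart of a face of
  \<open>\<tau>\<close> is the locus in the chart of \<open>\<tau>\<close> where a single character
  is nonzero. Smoothness supplies this character as a sum of dual basis vectors, and every point of
  the locus extends uniquely to the chart of the face by dividing by powers of the character.
  Transitivity of gluing, openness of charts and subfans, and independence of the divisor from the
  chart all come from this. The continuity of the contraction is not formal: the variety carries a
  final topology, and final topologies need not survive a product with the interval. Openness of the
  charts makes the question local. Irreducibility of \<open>v\<close> turns the ray into a face of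
  every cone containing \<open>v\<close>, so that the star can be described by membership of
  \<open>v\<close>.\<close>

lemma convex_cone_hull_finite:
  fixes S :: "'a::real_vector set"
  assumes "finite S"
  shows "convex_cone hull S = {\<Sum>b\<in>S. c b *\<^sub>R b | c. \<forall>b\<in>S. 0 \<le> c b}" (is "_ = ?R")
proof
  have "convex_cone ?R"
    unfolding convex_cone_iff
  proof (intro conjI ballI allI impI)
    show "0 \<in> ?R" by (rule CollectI) (rule exI[of _ "\<lambda>_. 0"], simp)
  next
    fix x y assume "x \<in> ?R" "y \<in> ?R"
    then obtain c d where "x = (\<Sum>b\<in>S. c b *\<^sub>R b)" "y = (\<Sum>b\<in>S. d b *\<^sub>R b)"
      "\<forall>b\<in>S. 0 \<le> c b" "\<forall>b\<in>S. 0 \<le> d b" by blast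
    then show "x + y \<in> ?R"
      by (intro CollectI exI[of _ "\<lambda>b. c b + d b"]) (simp add: scaleR_left_distrib sum.distrib)
  next
    fix x and t :: real assume "x \<in> ?R" "0 \<le> t"
    then obtain c where "x = (\<Sum>b\<in>S. c b *\<^sub>R b)" "\<forall>b\<in>S. 0 \<le> c b" by blast
    with \<open>0 \<le> t\<close> show "t *\<^sub>R x \<in> ?R"
      by (intro CollectI exI[of _ "\<lambda>b. t * c b"]) (simp add: scaleR_sum_right)
  qed
  moreover have "S \<subseteq> ?R"
  proof
    fix b assume "b \<in> S"
    then show "b \<in> ?R"
      using assms
      by (intro CollectI exI[of _ "\<lambda>a. if a = b then 1 else 0"])
        (simp add: if_distrib[where f = "\<lambda>r. r *\<^sub>R _"] cong: if_cong)
  qed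
  ultimately show "convex_cone hull S \<subseteq> ?R" by (rule hull_minimal[rotated])
next
  have "(\<Sum>b\<in>A. c b *\<^sub>R b) \<in> convex_cone hull S" if "A \<subseteq> S" "\<forall>b\<in>S. 0 \<le> c b" for A c
  proof -
    have "finite A" using that(1) assms finite_subset by blast
    then show ?thesis using that
      by (induction A)
        (auto intro!: convex_cone_hull_add convex_cone_hull_mul convex_cone_hull_contains_0
          intro: hull_inc)
  qed
  then show "?R \<subseteq> convex_cone hull S" by blast
qed

text \<open>Each coordinate functional extends linearly from the independent set to the whole space;
  \<open>adjoint f 1\<close> is the vector that represents it.\<close>

lemma dual_basis_exists:
  fixes B :: "'a::euclidean_space set"
  assumes "independent B"
  obtains d where "\<And>b b'. b \<in> B \<Longrightarrow> b' \<in> B \<Longrightarrow> d b \<bullet> b' = (if b = b' then 1 else 0)"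
proof -
  have "\<exists>d. \<forall>b'\<in>B. d \<bullet> b' = (if b = b' then 1 else 0)" for b
  proof -
    obtain f :: "'a \<Rightarrow> real" where f: "linear f" "\<forall>b'\<in>B. f b' = (if b = b' then 1 else 0)"
      using linear_independent_extend[OF assms, of "\<lambda>b'. if b = b' then 1 else 0"] by auto
    have "adjoint f 1 \<bullet> x = f x" for x
      using adjoint_works[OF f(1), of x 1] by (simp add: inner_commute)
    with f(2) show ?thesis by (intro exI[of _ "adjoint f 1"]) simp
  qed
  then show ?thesis using that by metis
qed

section \<open>Lattice bases and integral coordinates\<close>

lemma lattice_basis_finite: "lattice_basis N B \<Longrightarrow> finite B"
  by (simp add: lattice_basis_def finiteI_independent)

lemma lattice_basis_subset:
  assumes "lattice_basis N B"
  shows "B \<subseteq> N"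
proof
  fix b assume "b \<in> B"
  then have "b = (\<Sum>a\<in>B. of_int (if a = b then 1 else 0) *\<^sub>R a)"
    using lattice_basis_finite[OF assms]
    by (simp add: if_distrib[where f = "\<lambda>r. r *\<^sub>R _"] if_distrib[where f = of_int] cong: if_cong)
  then have "b \<in> {\<Sum>b\<in>B. of_int (c b) *\<^sub>R b | c :: real ^ _ \<Rightarrow> int. True}"
    by (intro CollectI exI conjI TrueI)
  then show "b \<in> N" using assms unfolding lattice_basis_def by simp
qed

text \<open>The pairing with \<open>d\<close> reads off the coordinate of \<open>x\<close> at
  \<open>b\<close>. This puts dual basis vectors into the dual lattice and makes the coefficients of
  lattice points integers.\<close>

lemma lattice_basis_coeff:
  assumes B: "lattice_basis N B" and "x \<in> N" "b \<in> B"
    and d: "\<And>b'. b' \<in> B \<Longrightarrow> d \<bullet> b' = (if b = b' then 1 else 0)"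
  shows "d \<bullet> x \<in> \<int>"
proof -
  obtain c :: "_ \<Rightarrow> int" where "x = (\<Sum>b\<in>B. of_int (c b) *\<^sub>R b)"
    using assms unfolding lattice_basis_def by auto
  then have "d \<bullet> x = (\<Sum>b'\<in>B. of_int (c b') * (if b = b' then 1 else 0))"
    by (simp add: inner_sum_right d)
  also have "\<dots> \<in> \<int>" by (intro Ints_sum) auto
  finally show ?thesis .
qed

section \<open>Faces of cones and the characters that cut them out\<close>

lemma face_is_cone:
  assumes "cone_face \<kappa> (convex_cone hull S)"
  shows "convex_cone \<kappa>"
  using assms face_of_conic[OF conic_convex_cone_hull] face_of_imp_convex
  unfolding cone_face_def convex_cone_def by blast

text \<open>The sum is the midpoint of \<open>2 *\<^sub>R x\<close> and
  \<open>2 *\<^sub>R y\<close>, to which the extremality of a face applies. If \<open>x = y\<close>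
  the open segment is empty and scaling takes its place.\<close>

lemma face_summand:
  assumes \<kappa>: "cone_face \<kappa> (convex_cone hull S)"
    and x: "x \<in> convex_cone hull S" and y: "y \<in> convex_cone hull S" and xy: "x + y \<in> \<kappa>"
  shows "x \<in> \<kappa>"
proof (cases "x = y")
  case True
  then have "x = (1/2) *\<^sub>R (x + y)" by (simp flip: scaleR_2)
  then show ?thesis using convex_cone_scaleR[OF face_is_cone[OF \<kappa>] _ xy, of "1/2"] by simp
next
  case False
  have "x + y \<in> open_segment (2 *\<^sub>R x) (2 *\<^sub>R y)"
    using False by (auto simp: in_segment intro!: exI[of _ "1/2"])
  moreover have "2 *\<^sub>R x \<in> convex_cone hull S" "2 *\<^sub>R y \<in> convex_cone hull S"
    using x y by (auto intro: convex_cone_hull_mul)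
  ultimately have "2 *\<^sub>R x \<in> \<kappa>"
    using \<kappa> xy unfolding cone_face_def by (blast dest: face_ofD)
  then show ?thesis
    using convex_cone_scaleR[OF face_is_cone[OF \<kappa>], of "1/2" "2 *\<^sub>R x"] by simp
qed

text \<open>A supporting hyperplane of \<open>\<tau>\<close> with normal in the dual lattice.
  Algebraically, inverting the character \<open>m\<close> turns the semigroup of
  \<open>\<tau>\<close> into that of \<open>\<kappa>\<close>.\<close>

definition cuts_out :: "(real ^ 'n) set \<Rightarrow> (real ^ 'n) set \<Rightarrow> (real ^ 'n) set \<Rightarrow> real ^ 'n \<Rightarrow> bool" where
  "cuts_out N \<tau> \<kappa> m \<longleftrightarrow> m \<in> cone_semigroup N \<tau> \<and> \<kappa> = {u \<in> \<tau>. m \<bullet> u = 0}"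

lemma dual_lattice_add: "m \<in> dual_lattice N \<Longrightarrow> m' \<in> dual_lattice N \<Longrightarrow> m + m' \<in> dual_lattice N"
  by (simp add: dual_lattice_def inner_add_left)

lemma dual_lattice_uminus: "m \<in> dual_lattice N \<Longrightarrow> - m \<in> dual_lattice N"
  by (simp add: dual_lattice_def)

lemma dual_lattice_0: "0 \<in> dual_lattice N"
  by (simp add: dual_lattice_def)

lemma dual_lattice_scaleR: "m \<in> dual_lattice N \<Longrightarrow> of_nat k *\<^sub>R m \<in> dual_lattice N"
  by (simp add: dual_lattice_def)

lemma dual_lattice_sum: "(\<And>i. i \<in> I \<Longrightarrow> f i \<in> dual_lattice N) \<Longrightarrow> sum f I \<in> dual_lattice N"
  by (induction I rule: infinite_finite_induct) (simp_all add: dual_lattice_add dual_lattice_0)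

lemma cone_semigroup_add:
  "m \<in> cone_semigroup N \<tau> \<Longrightarrow> m' \<in> cone_semigroup N \<tau> \<Longrightarrow> m + m' \<in> cone_semigroup N \<tau>"
  and cone_semigroup_0: "0 \<in> cone_semigroup N \<tau>"
  and cone_semigroup_scaleR: "m \<in> cone_semigroup N \<tau> \<Longrightarrow> of_nat k *\<^sub>R m \<in> cone_semigroup N \<tau>"
  by (auto simp: cone_semigroup_def dual_cone_def inner_add_left
      intro: dual_lattice_add dual_lattice_0 dual_lattice_scaleR)

lemma cone_semigroup_antimono: "\<kappa> \<subseteq> \<tau> \<Longrightarrow> cone_semigroup N \<tau> \<subseteq> cone_semigroup N \<kappa>"
  by (auto simp: cone_semigroup_def dual_cone_def)

text \<open>The normal is the sum of the dual vectors of those generators that lie outside the face.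
  It takes the value 0 on generators in the face and 1 on the others, so it vanishes at a point of
  the cone exactly if the point has no component along an outside generator.\<close>

lemma smooth_face_cut_out:
  assumes B: "lattice_basis N B" and S: "S \<subseteq> B" and \<tau>: "\<tau> = convex_cone hull S"
    and \<kappa>: "cone_face \<kappa> \<tau>"
  shows "\<exists>m. cuts_out N \<tau> \<kappa> m"
proof -
  obtain d where d: "\<And>b b'. b \<in> B \<Longrightarrow> b' \<in> B \<Longrightarrow> d b \<bullet> b' = (if b = b' then 1 else 0)"
    using dual_basis_exists B unfolding lattice_basis_def by metis
  have finS: "finite S" using lattice_basis_finite[OF B] S finite_subset by blast
  define m where "m = (\<Sum>b\<in>S - \<kappa>. d b)"
  have m_dot: "m \<bullet> b = (if b \<in> \<kappa> then 0 else 1)" if "b \<in> S" for b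
  proof -
    have "m \<bullet> b = (\<Sum>b'\<in>S - \<kappa>. if b' = b then 1 else 0)"
      unfolding m_def inner_sum_left using that S by (intro sum.cong) (auto simp: d subset_iff)
    then show ?thesis using that finS by simp
  qed
  have comb: "\<exists>c. x = (\<Sum>b\<in>S. c b *\<^sub>R b) \<and> (\<forall>b\<in>S. 0 \<le> c b)" if "x \<in> \<tau>" for x
    using that convex_cone_hull_finite[OF finS] unfolding \<tau> by auto
  have conv: "convex_cone \<kappa>" using face_is_cone \<kappa> \<tau> by blast
  have "m \<in> dual_lattice N"
    unfolding m_def
  proof (rule dual_lattice_sum)
    fix b assume "b \<in> S - \<kappa>"
    then show "d b \<in> dual_lattice N"
      using lattice_basis_coeff[OF B] d S unfolding dual_lattice_def by blast
  qed
  moreover have "m \<in> dual_cone \<tau>"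
    unfolding dual_cone_def
  proof (intro CollectI ballI)
    fix x assume "x \<in> \<tau>"
    with comb obtain c where c: "x = (\<Sum>b\<in>S. c b *\<^sub>R b)" "\<forall>b\<in>S. 0 \<le> c b" by blast
    then show "0 \<le> m \<bullet> x"
      by (auto simp: inner_sum_right m_dot intro!: sum_nonneg)
  qed
  moreover have "x \<in> \<kappa> \<longleftrightarrow> m \<bullet> x = 0" if "x \<in> \<tau>" for x
  proof -
    from comb[OF that] obtain c where c: "x = (\<Sum>b\<in>S. c b *\<^sub>R b)" "\<forall>b\<in>S. 0 \<le> c b" by blast
    have mx: "m \<bullet> x = (\<Sum>b\<in>S. c b * (if b \<in> \<kappa> then 0 else 1))"
      unfolding c(1) by (simp add: inner_sum_right m_dot)
    also have "\<dots> = 0 \<longleftrightarrow> (\<forall>b\<in>S. b \<notin> \<kappa> \<longrightarrow> c b = 0)"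
      using c(2) by (subst sum_nonneg_eq_0_iff[OF finS]) auto
    also have "\<dots> \<longleftrightarrow> x \<in> \<kappa>"
    proof
      assume *: "\<forall>b\<in>S. b \<notin> \<kappa> \<longrightarrow> c b = 0"
      have "(\<Sum>b\<in>A. c b *\<^sub>R b) \<in> \<kappa>" if "A \<subseteq> S" for A
      proof -
        have "finite A" using that finS finite_subset by blast
        then show ?thesis using that
        proof (induction A)
          case (insert b A)
          then have "c b *\<^sub>R b \<in> \<kappa>"
            using * c(2) convex_cone_scaleR[OF conv] convex_cone_contains_0[OF conv]
            by (cases "b \<in> \<kappa>") auto
          with insert show ?case using convex_cone_add[OF conv] by simp
        qed (simp add: convex_cone_contains_0[OF conv])
      qed
      then show "x \<in> \<kappa>" using c(1) by blast
    next
      assume x: "x \<in> \<kappa>"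
      show "\<forall>b\<in>S. b \<notin> \<kappa> \<longrightarrow> c b = 0"
      proof (intro ballI impI, rule ccontr)
        fix b assume b: "b \<in> S" "b \<notin> \<kappa>" "c b \<noteq> 0"
        then have pos: "0 < c b" using c(2) by force
        \<comment> \<open>Extremality applied to this splitting puts \<open>c b *\<^sub>R b\<close>
          into \<open>\<kappa>\<close>, and rescaling then does the same for
          \<open>b\<close>.\<close>
        have split: "x = c b *\<^sub>R b + (\<Sum>a\<in>S - {b}. c a *\<^sub>R a)"
          unfolding c(1) using finS b(1) by (rule sum.remove)
        have "(\<Sum>a\<in>S - {b}. c a *\<^sub>R a) \<in> convex_cone hull (S - {b})"
          using c(2) finS by (subst convex_cone_hull_finite) auto
        then have "(\<Sum>a\<in>S - {b}. c a *\<^sub>R a) \<in> \<tau>"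
          unfolding \<tau> using hull_mono[of "S - {b}" S] by blast
        moreover have "c b *\<^sub>R b \<in> \<tau>"
          unfolding \<tau> using pos b(1) by (intro convex_cone_hull_mul hull_inc) auto
        ultimately have "c b *\<^sub>R b \<in> \<kappa>"
          using face_summand[of \<kappa> S] \<kappa> x split unfolding \<tau> by metis
        then have "(1 / c b) *\<^sub>R c b *\<^sub>R b \<in> \<kappa>"
          using convex_cone_scaleR[OF conv] pos by (meson less_imp_le zero_le_divide_1_iff)
        then show False using b pos by simp
      qed
    qed
    finally show ?thesis by blast
  qed
  ultimately have "cuts_out N \<tau> \<kappa> m"
    using \<kappa> face_of_imp_subset unfolding cuts_out_def cone_semigroup_def cone_face_def by blast
  then show ?thesis ..
qed

text \<open>Both characters are nonnegative on the cone, so their sum vanishes only where both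
  do.\<close>

lemma cuts_out_Int:
  assumes "cuts_out N \<tau> \<kappa> m" "cuts_out N \<tau> \<kappa>' m'"
  shows "cuts_out N \<tau> (\<kappa> \<inter> \<kappa>') (m + m')"
proof -
  have "0 \<le> m \<bullet> u" "0 \<le> m' \<bullet> u" if "u \<in> \<tau>" for u
    using that assms unfolding cuts_out_def cone_semigroup_def dual_cone_def by auto
  then have "m \<bullet> u + m' \<bullet> u = 0 \<longleftrightarrow> m \<bullet> u = 0 \<and> m' \<bullet> u = 0" if "u \<in> \<tau>" for u
    using that by (simp add: add_nonneg_eq_0_iff)
  then show ?thesis
    using assms unfolding cuts_out_def by (auto simp: cone_semigroup_add inner_add_left)
qed

lemma cuts_out_subset: "cuts_out N \<tau> \<kappa> m \<Longrightarrow> \<kappa> \<subseteq> \<tau>"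
  by (auto simp: cuts_out_def)

text \<open>Since \<open>m\<close> vanishes on the face, both signs are nonnegative there:
  \<open>m\<close> becomes a unit of the semigroup of the face.\<close>

lemma cuts_out_inverse:
  assumes "cuts_out N \<tau> \<kappa> m"
  shows "m \<in> cone_semigroup N \<kappa>" "- m \<in> cone_semigroup N \<kappa>"
  using assms by (auto simp: cuts_out_def cone_semigroup_def dual_cone_def intro: dual_lattice_uminus)

text \<open>This is the localization property. On a generator where \<open>m\<close> is positive, a
  large multiple of \<open>m\<close> outweighs \<open>m'\<close>; a generator where \<open>m\<close>
  vanishes lies in \<open>\<kappa>\<close>, where \<open>m'\<close> is already nonnegative.\<close>

lemma cuts_out_shift:
  assumes \<tau>: "rational_cone N \<tau>" and m: "cuts_out N \<tau> \<kappa> m" and m': "m' \<in> cone_semigroup N \<kappa>"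
  shows "\<exists>k::nat. m' + of_nat k *\<^sub>R m \<in> cone_semigroup N \<tau>"
proof -
  obtain S where S: "finite S" "\<tau> = convex_cone hull S"
    using \<tau> unfolding rational_cone_def by blast
  have Sm: "0 \<le> m \<bullet> b" if "b \<in> S" for b
    using m that hull_inc[of b S] S(2) unfolding cuts_out_def cone_semigroup_def dual_cone_def by blast
  \<comment> \<open>Validity for all larger \<open>j\<close> allows one exponent to serve the
    finitely many generators together.\<close>
  have "\<exists>k::nat. \<forall>j\<ge>k. 0 \<le> m' \<bullet> b + of_nat j * (m \<bullet> b)" if "b \<in> S" for b
  proof (cases "m \<bullet> b = 0")
    case True
    then have "b \<in> \<kappa>" using m that hull_inc[of b S] S(2) unfolding cuts_out_def by blast
    then show ?thesis using m' True unfolding cone_semigroup_def dual_cone_def by auto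
  next
    case False
    then have pos: "0 < m \<bullet> b" using Sm[OF that] by simp
    then obtain k :: nat where k: "- (m' \<bullet> b) < of_nat k * (m \<bullet> b)"
      using reals_Archimedean3 by blast
    have "0 \<le> m' \<bullet> b + of_nat j * (m \<bullet> b)" if "k \<le> j" for j
    proof -
      have "of_nat k * (m \<bullet> b) \<le> of_nat j * (m \<bullet> b)"
        using that pos by (intro mult_right_mono) auto
      with k show ?thesis by linarith
    qed
    then show ?thesis by blast
  qed
  then obtain k :: "_ \<Rightarrow> nat" where
    k: "\<And>b j. b \<in> S \<Longrightarrow> k b \<le> j \<Longrightarrow> 0 \<le> m' \<bullet> b + of_nat j * (m \<bullet> b)" by metis
  obtain K where K: "\<forall>b\<in>S. k b \<le> K"
    using S(1) by (metis finite_imageI finite_nat_set_iff_bounded_le imageI)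
  have "m' + of_nat K *\<^sub>R m \<in> dual_cone \<tau>"
    unfolding dual_cone_def
  proof (intro CollectI ballI)
    fix x assume "x \<in> \<tau>"
    then obtain c where c: "x = (\<Sum>b\<in>S. c b *\<^sub>R b)" "\<forall>b\<in>S. 0 \<le> c b"
      unfolding S(2) convex_cone_hull_finite[OF S(1)] by blast
    have "0 \<le> (m' + of_nat K *\<^sub>R m) \<bullet> b" if "b \<in> S" for b
      using k[of b K] K that by (simp add: inner_add_left)
    then show "0 \<le> (m' + of_nat K *\<^sub>R m) \<bullet> x"
      unfolding c(1) inner_sum_right using c(2) by (intro sum_nonneg) auto
  qed
  moreover have "m' + of_nat K *\<^sub>R m \<in> dual_lattice N"
    using m m' unfolding cuts_out_def cone_semigroup_def
    by (intro dual_lattice_add dual_lattice_scaleR) auto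
  ultimately show ?thesis unfolding cone_semigroup_def by blast
qed

section \<open>Charts of faces\<close>

lemma continuous_map_mult:
  fixes f g :: "'a \<Rightarrow> 'b::real_normed_algebra"
  assumes "continuous_map X euclidean f" "continuous_map X euclidean g"
  shows "continuous_map X euclidean (\<lambda>x. f x * g x)"
  using assms by (auto simp: continuous_map_atin limitin_canonical_iff intro: tendsto_mult)

lemma continuous_map_power:
  fixes f :: "'a \<Rightarrow> 'b::real_normed_algebra_1"
  assumes "continuous_map X euclidean f"
  shows "continuous_map X euclidean (\<lambda>x. f x ^ k)"
  using assms by (auto simp: continuous_map_atin limitin_canonical_iff intro: tendsto_power)

lemma continuous_map_divide:
  fixes f g :: "'a \<Rightarrow> 'b::real_normed_field"
  assumes "continuous_map X euclidean f" "continuous_map X euclidean g"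
    and "\<And>x. x \<in> topspace X \<Longrightarrow> g x \<noteq> 0"
  shows "continuous_map X euclidean (\<lambda>x. f x / g x)"
  using assms by (auto simp: continuous_map_atin limitin_canonical_iff intro!: tendsto_divide)

section \<open>Points of a chart as monoid homomorphisms, and their localization\<close>

lemma affine_points_1: "\<gamma> \<in> affine_points N \<tau> \<Longrightarrow> \<gamma> 0 = 1"
  by (simp add: affine_points_def)

lemma affine_points_mult:
  "\<gamma> \<in> affine_points N \<tau> \<Longrightarrow> m \<in> cone_semigroup N \<tau> \<Longrightarrow> m' \<in> cone_semigroup N \<tau> \<Longrightarrow>
   \<gamma> (m + m') = \<gamma> m * \<gamma> m'"
  by (simp add: affine_points_def)

lemma affine_points_extensional: "\<gamma> \<in> affine_points N \<tau> \<Longrightarrow> \<gamma> \<in> extensional (cone_semigroup N \<tau>)"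
  by (simp add: affine_points_def)

lemma affine_points_power:
  assumes "\<gamma> \<in> affine_points N \<tau>" "m \<in> cone_semigroup N \<tau>"
  shows "\<gamma> (of_nat k *\<^sub>R m) = \<gamma> m ^ k"
proof (induction k)
  case (Suc k)
  have "of_nat (Suc k) *\<^sub>R m = m + of_nat k *\<^sub>R m"
    by (simp add: scaleR_left_distrib)
  then show ?case
    using affine_points_mult[OF assms cone_semigroup_scaleR[OF assms(2)], of k] Suc by simp
qed (simp add: affine_points_1[OF assms(1)])

lemma affine_points_sum:
  assumes "\<gamma> \<in> affine_points N \<tau>" "\<And>i. i \<in> I \<Longrightarrow> f i \<in> cone_semigroup N \<tau>"
  shows "sum f I \<in> cone_semigroup N \<tau> \<and> \<gamma> (sum f I) = (\<Prod>i\<in>I. \<gamma> (f i))"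
  using assms(2)
proof (induction I rule: infinite_finite_induct)
  case (insert i I)
  then show ?case using affine_points_mult[OF assms(1)] by (simp add: cone_semigroup_add)
qed (simp_all add: affine_points_1[OF assms(1)] cone_semigroup_0)

lemma affine_points_restrict:
  assumes "\<kappa> \<subseteq> \<tau>" "\<delta> \<in> affine_points N \<kappa>"
  shows "restrict \<delta> (cone_semigroup N \<tau>) \<in> affine_points N \<tau>"
  using assms(2) cone_semigroup_antimono[OF assms(1)]
  by (auto simp: affine_points_def cone_semigroup_add cone_semigroup_0 subset_iff)

text \<open>Both \<open>m\<close> and \<open>- m\<close> are characters on the chart of the face,
  and the product of their values is \<open>\<delta> 0 = 1\<close>.\<close>

lemma affine_points_cut_nonzero:
  assumes "cuts_out N \<tau> \<kappa> m" "\<delta> \<in> affine_points N \<kappa>"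
  shows "\<delta> m \<noteq> 0"
proof -
  have "\<delta> m * \<delta> (- m) = 1"
    using affine_points_mult[OF assms(2) cuts_out_inverse[OF assms(1)]]
    by (simp add: affine_points_1[OF assms(2)])
  then show ?thesis by auto
qed

lemma affine_points_shift:
  assumes m: "cuts_out N \<tau> \<kappa> m" and \<delta>: "\<delta> \<in> affine_points N \<kappa>" and m': "m' \<in> cone_semigroup N \<kappa>"
  shows "\<delta> m' = \<delta> (m' + of_nat k *\<^sub>R m) / \<delta> m ^ k"
  using affine_points_mult[OF \<delta> m' cone_semigroup_scaleR[OF cuts_out_inverse(1)[OF m]], of k]
    affine_points_power[OF \<delta> cuts_out_inverse(1)[OF m], of k] affine_points_cut_nonzero[OF m \<delta>]
  by simp

text \<open>Every character of the face is a quotient of a character of \<open>\<tau>\<close> by a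
  power of \<open>m\<close>, so the values on the smaller semigroup determine the point.\<close>

lemma affine_points_eqI:
  assumes \<tau>: "rational_cone N \<tau>" and m: "cuts_out N \<tau> \<kappa> m"
    and \<delta>: "\<delta> \<in> affine_points N \<kappa>" "\<delta>' \<in> affine_points N \<kappa>"
    and eq: "restrict \<delta> (cone_semigroup N \<tau>) = restrict \<delta>' (cone_semigroup N \<tau>)"
  shows "\<delta> = \<delta>'"
proof (rule extensionalityI[OF affine_points_extensional[OF \<delta>(1)] affine_points_extensional[OF \<delta>(2)]])
  fix m' assume m': "m' \<in> cone_semigroup N \<kappa>"
  have eq': "\<delta> x = \<delta>' x" if "x \<in> cone_semigroup N \<tau>" for x
    using that eq by (metis restrict_apply')
  obtain k :: nat where "m' + of_nat k *\<^sub>R m \<in> cone_semigroup N \<tau>"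
    using cuts_out_shift[OF \<tau> m m'] by blast
  moreover have "m \<in> cone_semigroup N \<tau>" using m unfolding cuts_out_def by blast
  ultimately show "\<delta> m' = \<delta>' m'"
    using affine_points_shift[OF m \<delta>(1) m', of k] affine_points_shift[OF m \<delta>(2) m', of k] eq' by simp
qed

text \<open>The inverse of restriction on the locus \<open>\<gamma> m \<noteq> 0\<close>: a
  character of the face is evaluated as a fraction whose denominator is a power of \<open>m\<close>.
  The exponent picked by \<open>SOME\<close> is immaterial by
  \<open>extend_point_eq\<close>.\<close>

definition extend_point ::
    "(real ^ 'n) set \<Rightarrow> (real ^ 'n) set \<Rightarrow> (real ^ 'n) set \<Rightarrow> real ^ 'n \<Rightarrow>
     (real ^ 'n \<Rightarrow> complex) \<Rightarrow> (real ^ 'n \<Rightarrow> complex)" where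
  "extend_point N \<tau> \<kappa> m \<gamma> =
     (\<lambda>m'\<in>cone_semigroup N \<kappa>.
        let k = (SOME k::nat. m' + of_nat k *\<^sub>R m \<in> cone_semigroup N \<tau>)
        in \<gamma> (m' + of_nat k *\<^sub>R m) / \<gamma> m ^ k)"

text \<open>Two admissible exponents \<open>k\<close> and \<open>j\<close> give the same fraction:
  after cross-multiplication both numerators become the value at
  \<open>m' + of_nat (k + j) *\<^sub>R m\<close>.\<close>

lemma extend_point_eq:
  assumes \<tau>: "rational_cone N \<tau>" and m: "cuts_out N \<tau> \<kappa> m"
    and \<gamma>: "\<gamma> \<in> affine_points N \<tau>" "\<gamma> m \<noteq> 0" and m': "m' \<in> cone_semigroup N \<kappa>"
    and k: "m' + of_nat k *\<^sub>R m \<in> cone_semigroup N \<tau>"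
  shows "extend_point N \<tau> \<kappa> m \<gamma> m' = \<gamma> (m' + of_nat k *\<^sub>R m) / \<gamma> m ^ k"
proof -
  define j where "j = (SOME j::nat. m' + of_nat j *\<^sub>R m \<in> cone_semigroup N \<tau>)"
  have j: "m' + of_nat j *\<^sub>R m \<in> cone_semigroup N \<tau>"
    unfolding j_def using k by (rule someI)
  have m\<tau>: "m \<in> cone_semigroup N \<tau>" using m unfolding cuts_out_def by blast
  have "\<gamma> (m' + of_nat k *\<^sub>R m) * \<gamma> m ^ j = \<gamma> ((m' + of_nat k *\<^sub>R m) + of_nat j *\<^sub>R m)"
    using affine_points_mult[OF \<gamma>(1) k cone_semigroup_scaleR[OF m\<tau>]]
      affine_points_power[OF \<gamma>(1) m\<tau>] by simp
  also have "\<dots> = \<gamma> ((m' + of_nat j *\<^sub>R m) + of_nat k *\<^sub>R m)"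
    by (simp add: algebra_simps)
  also have "\<dots> = \<gamma> (m' + of_nat j *\<^sub>R m) * \<gamma> m ^ k"
    using affine_points_mult[OF \<gamma>(1) j cone_semigroup_scaleR[OF m\<tau>]]
      affine_points_power[OF \<gamma>(1) m\<tau>] by simp
  finally show ?thesis
    using m' \<gamma>(2) by (simp add: extend_point_def Let_def flip: j_def) (simp add: field_simps)
qed

lemma extend_point_in:
  assumes \<tau>: "rational_cone N \<tau>" and m: "cuts_out N \<tau> \<kappa> m"
    and \<gamma>: "\<gamma> \<in> affine_points N \<tau>" "\<gamma> m \<noteq> 0"
  shows "extend_point N \<tau> \<kappa> m \<gamma> \<in> affine_points N \<kappa>"
    and "restrict (extend_point N \<tau> \<kappa> m \<gamma>) (cone_semigroup N \<tau>) = \<gamma>"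
proof -
  note ev = extend_point_eq[OF \<tau> m \<gamma>]
  have m\<tau>: "m \<in> cone_semigroup N \<tau>" using m unfolding cuts_out_def by blast
  \<comment> \<open>Exponent 0 is admissible for a character of \<open>\<tau>\<close>, so nothing is
    divided.\<close>
  have eq: "extend_point N \<tau> \<kappa> m \<gamma> m' = \<gamma> m'" if "m' \<in> cone_semigroup N \<tau>" for m'
    using ev[of m' 0] that cone_semigroup_antimono[OF cuts_out_subset[OF m]] by auto
  show "restrict (extend_point N \<tau> \<kappa> m \<gamma>) (cone_semigroup N \<tau>) = \<gamma>"
    using eq affine_points_extensional[OF \<gamma>(1)] by (intro extensionalityI) auto
  have "extend_point N \<tau> \<kappa> m \<gamma> (x + y) = extend_point N \<tau> \<kappa> m \<gamma> x * extend_point N \<tau> \<kappa> m \<gamma> y"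
    if xy: "x \<in> cone_semigroup N \<kappa>" "y \<in> cone_semigroup N \<kappa>" for x y
  proof -
    obtain k :: nat where k: "x + of_nat k *\<^sub>R m \<in> cone_semigroup N \<tau>"
      using cuts_out_shift[OF \<tau> m xy(1)] by blast
    obtain j :: nat where j: "y + of_nat j *\<^sub>R m \<in> cone_semigroup N \<tau>"
      using cuts_out_shift[OF \<tau> m xy(2)] by blast
    \<comment> \<open>The exponents add, which gives the product of the two fractions its common
      denominator \<open>\<gamma> m ^ (k + j)\<close>.\<close>
    have sum: "(x + y) + of_nat (k + j) *\<^sub>R m = (x + of_nat k *\<^sub>R m) + (y + of_nat j *\<^sub>R m)"
      by (simp add: algebra_simps)
    have "(x + y) + of_nat (k + j) *\<^sub>R m \<in> cone_semigroup N \<tau>"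
      unfolding sum using cone_semigroup_add[OF k j] .
    from ev[OF cone_semigroup_add[OF xy] this]
    show ?thesis
      unfolding sum affine_points_mult[OF \<gamma>(1) k j] ev[OF xy(1) k] ev[OF xy(2) j]
      by (simp add: power_add)
  qed
  moreover have "extend_point N \<tau> \<kappa> m \<gamma> 0 = 1"
    using eq[OF cone_semigroup_0] affine_points_1[OF \<gamma>(1)] by simp
  moreover have "extend_point N \<tau> \<kappa> m \<gamma> \<in> extensional (cone_semigroup N \<kappa>)"
    by (simp add: extend_point_def)
  ultimately show "extend_point N \<tau> \<kappa> m \<gamma> \<in> affine_points N \<kappa>"
    by (simp add: affine_points_def)
qed

lemma restrict_affine_points_image:
  assumes \<tau>: "rational_cone N \<tau>" and m: "cuts_out N \<tau> \<kappa> m"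
  shows "(\<lambda>\<delta>. restrict \<delta> (cone_semigroup N \<tau>)) ` affine_points N \<kappa> = {\<gamma> \<in> affine_points N \<tau>. \<gamma> m \<noteq> 0}"
proof -
  have "m \<in> cone_semigroup N \<tau>" using m unfolding cuts_out_def by blast
  then have "(\<lambda>\<delta>. restrict \<delta> (cone_semigroup N \<tau>)) ` affine_points N \<kappa> \<subseteq> {\<gamma> \<in> affine_points N \<tau>. \<gamma> m \<noteq> 0}"
    using affine_points_restrict[OF cuts_out_subset[OF m]] affine_points_cut_nonzero[OF m] by auto
  moreover have "{\<gamma> \<in> affine_points N \<tau>. \<gamma> m \<noteq> 0} \<subseteq> (\<lambda>\<delta>. restrict \<delta> (cone_semigroup N \<tau>)) ` affine_points N \<kappa>"
  proof
    fix \<gamma> assume "\<gamma> \<in> {\<gamma> \<in> affine_points N \<tau>. \<gamma> m \<noteq> 0}"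
    then show "\<gamma> \<in> (\<lambda>\<delta>. restrict \<delta> (cone_semigroup N \<tau>)) ` affine_points N \<kappa>"
      using extend_point_in[OF \<tau> m, of \<gamma>] by (intro image_eqI[of _ _ "extend_point N \<tau> \<kappa> m \<gamma>"]) auto
  qed
  ultimately show ?thesis by blast
qed

lemma openin_Zariski_face:
  assumes \<tau>: "rational_cone N \<tau>" and m: "cuts_out N \<tau> \<kappa> m"
  shows "openin (affine_Zariski N \<tau>) ((\<lambda>\<delta>. restrict \<delta> (cone_semigroup N \<tau>)) ` affine_points N \<kappa>)"
proof -
  have "m \<in> cone_semigroup N \<tau>" using m unfolding cuts_out_def by blast
  then show ?thesis
    unfolding restrict_affine_points_image[OF assms] affine_Zariski_def
    by (intro topology_generated_by_Basis CollectI exI[of _ "{m}"] exI[of _ "\<lambda>_. 1"]) simp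
qed

section \<open>Face charts in the classical topology\<close>

lemma continuous_map_affine_classical:
  "continuous_map X (affine_classical N \<tau>) f \<longleftrightarrow>
     f ` topspace X \<subseteq> affine_points N \<tau> \<and>
     (\<forall>m\<in>cone_semigroup N \<tau>. continuous_map X euclidean (\<lambda>x. f x m))"
  unfolding affine_classical_def continuous_map_in_subtopology continuous_map_componentwise
  using affine_points_extensional by blast

lemma continuous_map_affine_eval:
  "m \<in> cone_semigroup N \<tau> \<Longrightarrow> continuous_map (affine_classical N \<tau>) euclidean (\<lambda>\<gamma>. \<gamma> m)"
  using continuous_map_affine_classical[of "affine_classical N \<tau>" N \<tau> id] by simp

lemma continuous_map_affine_restrict:
  assumes "\<kappa> \<subseteq> \<tau>"
  shows "continuous_map (affine_classical N \<kappa>) (affine_classical N \<tau>) (\<lambda>\<delta>. restrict \<delta> (cone_semigroup N \<tau>))"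
  unfolding continuous_map_affine_classical
  using affine_points_restrict[OF assms]
  by (auto simp: topspace_affine_classical
      intro!: continuous_map_affine_eval subsetD[OF cone_semigroup_antimono[OF assms]])

text \<open>Restriction is an open embedding onto the locus \<open>\<gamma> m \<noteq> 0\<close>.
  Its inverse \<open>extend_point\<close> is continuous there, being in each coordinate a quotient
  with nonvanishing denominator, and the image of \<open>V\<close> is the preimage of
  \<open>V\<close> under this inverse.\<close>

lemma openin_classical_face:
  assumes \<tau>: "rational_cone N \<tau>" and m: "cuts_out N \<tau> \<kappa> m" and V: "openin (affine_classical N \<kappa>) V"
  shows "openin (affine_classical N \<tau>) ((\<lambda>\<delta>. restrict \<delta> (cone_semigroup N \<tau>)) ` V)"
proof -
  define D where "D = subtopology (affine_classical N \<tau>) {\<gamma> \<in> affine_points N \<tau>. \<gamma> m \<noteq> 0}"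
  have m\<tau>: "m \<in> cone_semigroup N \<tau>" using m unfolding cuts_out_def by blast
  have topD: "topspace D = {\<gamma> \<in> affine_points N \<tau>. \<gamma> m \<noteq> 0}"
    by (auto simp: D_def topspace_affine_classical)
  have eval: "continuous_map D euclidean (\<lambda>\<gamma>. \<gamma> m')" if "m' \<in> cone_semigroup N \<tau>" for m'
    unfolding D_def using that by (intro continuous_map_from_subtopology continuous_map_affine_eval)
  have cont: "continuous_map D (affine_classical N \<kappa>) (extend_point N \<tau> \<kappa> m)"
    unfolding continuous_map_affine_classical
  proof (intro conjI ballI)
    show "extend_point N \<tau> \<kappa> m ` topspace D \<subseteq> affine_points N \<kappa>"
      unfolding topD using extend_point_in(1)[OF \<tau> m] by blast
  next
    fix m' assume m': "m' \<in> cone_semigroup N \<kappa>"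
    obtain k :: nat where k: "m' + of_nat k *\<^sub>R m \<in> cone_semigroup N \<tau>"
      using cuts_out_shift[OF \<tau> m m'] by blast
    have "continuous_map D euclidean (\<lambda>\<gamma>. \<gamma> (m' + of_nat k *\<^sub>R m) / \<gamma> m ^ k)"
      using topD by (intro continuous_map_divide continuous_map_power eval k m\<tau>) auto
    then show "continuous_map D euclidean (\<lambda>\<gamma>. extend_point N \<tau> \<kappa> m \<gamma> m')"
      by (rule continuous_map_eq) (use extend_point_eq[OF \<tau> m _ _ m' k] topD in auto)
  qed
  have "openin (affine_classical N \<tau>) {\<gamma> \<in> topspace (affine_classical N \<tau>). \<gamma> m \<in> - {0}}"
    by (rule openin_continuous_map_preimage[OF continuous_map_affine_eval[OF m\<tau>]]) auto
  then have openD: "openin (affine_classical N \<tau>) {\<gamma> \<in> affine_points N \<tau>. \<gamma> m \<noteq> 0}"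
    by (simp add: topspace_affine_classical)
  have "openin D {\<gamma> \<in> topspace D. extend_point N \<tau> \<kappa> m \<gamma> \<in> V}"
    using openin_continuous_map_preimage[OF cont V] .
  then have "openin (affine_classical N \<tau>) {\<gamma> \<in> topspace D. extend_point N \<tau> \<kappa> m \<gamma> \<in> V}"
    unfolding D_def by (simp only: openin_open_subtopology[OF openD])
  moreover have "{\<gamma> \<in> topspace D. extend_point N \<tau> \<kappa> m \<gamma> \<in> V} =
      (\<lambda>\<delta>. restrict \<delta> (cone_semigroup N \<tau>)) ` V" (is "?L = ?R")
  proof
    show "?L \<subseteq> ?R"
    proof
      fix \<gamma> assume "\<gamma> \<in> ?L"
      then show "\<gamma> \<in> ?R"
        unfolding topD using extend_point_in(2)[OF \<tau> m, of \<gamma>]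
        by (intro image_eqI[of _ _ "extend_point N \<tau> \<kappa> m \<gamma>"]) auto
    qed
  next
    have VU: "V \<subseteq> affine_points N \<kappa>"
      using openin_subset[OF V] topspace_affine_classical by blast
    show "?R \<subseteq> ?L"
    proof
      fix \<gamma> assume "\<gamma> \<in> ?R"
      then obtain \<delta> where \<delta>: "\<delta> \<in> V" "\<gamma> = restrict \<delta> (cone_semigroup N \<tau>)" by blast
      then have \<gamma>: "\<gamma> \<in> affine_points N \<tau>" "\<gamma> m \<noteq> 0"
        using affine_points_restrict[OF cuts_out_subset[OF m]] affine_points_cut_nonzero[OF m] VU m\<tau>
        by auto
      have "extend_point N \<tau> \<kappa> m \<gamma> = \<delta>"
        using \<delta> VU extend_point_in(2)[OF \<tau> m \<gamma>]
        by (intro affine_points_eqI[OF \<tau> m extend_point_in(1)[OF \<tau> m \<gamma>]]) (blast, simp only:)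
      with \<delta> \<gamma> topD show "\<gamma> \<in> ?L" by simp
    qed
  qed
  ultimately show ?thesis by simp
qed

section \<open>Gluing\<close>

lemma cone_face_subset: "cone_face \<kappa> \<tau> \<Longrightarrow> \<kappa> \<subseteq> \<tau>"
  unfolding cone_face_def by (blast dest: face_of_imp_subset)

lemma cone_face_trans: "cone_face \<kappa> \<tau> \<Longrightarrow> cone_face \<tau> \<eta> \<Longrightarrow> cone_face \<kappa> \<eta>"
  unfolding cone_face_def by (blast intro: face_of_trans)

lemma rational_cone_face_refl: "rational_cone N \<tau> \<Longrightarrow> cone_face \<tau> \<tau>"
  unfolding rational_cone_def cone_face_def
  using convex_convex_cone_hull convex_cone_hull_nonempty face_of_refl by metis

lemma rational_cone_face_0:
  assumes "rational_cone N \<tau>" "cone_face \<kappa> \<tau>"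
  shows "0 \<in> \<kappa>"
  using assms face_is_cone convex_cone_contains_0 unfolding rational_cone_def by metis

lemma restrict_restrict_subset: "A \<subseteq> B \<Longrightarrow> restrict (restrict f B) A = restrict f A"
  by (simp add: Int_absorb1)

lemma toric_glueI:
  assumes "rational_cone N \<tau>" "rational_cone N \<tau>'" "cone_face \<kappa> \<tau>" "cone_face \<kappa> \<tau>'"
    "\<delta> \<in> affine_points N \<kappa>"
    "\<gamma> = restrict \<delta> (cone_semigroup N \<tau>)" "\<gamma>' = restrict \<delta> (cone_semigroup N \<tau>')"
  shows "((\<tau>, \<gamma>), (\<tau>', \<gamma>')) \<in> toric_glue N"
  using assms unfolding toric_glue_def by blast

lemma toric_glueE:
  assumes "((\<tau>, \<gamma>), (\<tau>', \<gamma>')) \<in> toric_glue N"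
  obtains \<kappa> \<delta> where "rational_cone N \<tau>" "rational_cone N \<tau>'" "cone_face \<kappa> \<tau>" "cone_face \<kappa> \<tau>'"
    "\<delta> \<in> affine_points N \<kappa>"
    "\<gamma> = restrict \<delta> (cone_semigroup N \<tau>)" "\<gamma>' = restrict \<delta> (cone_semigroup N \<tau>')"
  using assms unfolding toric_glue_def by blast

lemma toric_glue_sym: "((\<tau>, \<gamma>), (\<tau>', \<gamma>')) \<in> toric_glue N \<Longrightarrow> ((\<tau>', \<gamma>'), (\<tau>, \<gamma>)) \<in> toric_glue N"
  unfolding toric_glue_def by blast

lemma toric_glue_face:
  assumes "rational_cone N \<tau>" "rational_cone N \<kappa>" "cone_face \<kappa> \<tau>" "\<delta> \<in> affine_points N \<kappa>"
  shows "((\<kappa>, \<delta>), (\<tau>, restrict \<delta> (cone_semigroup N \<tau>))) \<in> toric_glue N"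
  using assms extensional_restrict[OF affine_points_extensional[OF assms(4)]]
  by (intro toric_glueI[of N \<kappa> \<tau> \<kappa> \<delta>]) (auto intro: rational_cone_face_refl)

text \<open>Smoothness enters most of the gluing arguments through \<open>face_cut\<close>: lattice
  bases provide a character cutting out any given face.\<close>

locale smooth_toric_fan =
  fixes N :: "(real ^ 'n) set" and \<Xi> :: "(real ^ 'n) set set"
  assumes smooth: "smooth_fan N \<Xi>"
begin

lemma rational: "\<tau> \<in> \<Xi> \<Longrightarrow> rational_cone N \<tau>"
  using smooth unfolding smooth_fan_def fan_def by blast

lemma face_mem: "\<tau> \<in> \<Xi> \<Longrightarrow> cone_face \<kappa> \<tau> \<Longrightarrow> \<kappa> \<in> \<Xi>"
  using smooth unfolding smooth_fan_def fan_def by blast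

lemma face_Int: "\<tau> \<in> \<Xi> \<Longrightarrow> \<tau>' \<in> \<Xi> \<Longrightarrow> cone_face (\<tau> \<inter> \<tau>') \<tau> \<and> cone_face (\<tau> \<inter> \<tau>') \<tau>'"
  using smooth unfolding smooth_fan_def fan_def by blast

lemma finite_fan: "finite \<Xi>"
  using smooth unfolding smooth_fan_def fan_def by blast

lemma smooth_cone:
  assumes "\<tau> \<in> \<Xi>"
  obtains B S where "lattice_basis N B" "S \<subseteq> B" "\<tau> = convex_cone hull S"
  using smooth assms unfolding smooth_fan_def by blast

lemma face_cut:
  assumes "\<tau> \<in> \<Xi>" "cone_face \<kappa> \<tau>"
  obtains m where "cuts_out N \<tau> \<kappa> m"
  using smooth_cone[OF assms(1)] smooth_face_cut_out assms(2) by metis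

text \<open>The point in the middle chart lies in the charts of both gluing faces, so
  \<open>m1\<close> and \<open>m2\<close> are nonzero at it, and so is their sum. Hence it extends
  to the intersection of these faces, which is a face of both outer cones. The outer cones range
  over all rational cones because the classes in \<open>toric_point\<close> do.\<close>

lemma toric_glue_trans:
  assumes \<tau>: "\<tau> \<in> \<Xi>"
    and 1: "((\<tau>1, \<gamma>1), (\<tau>, \<gamma>)) \<in> toric_glue N" and 2: "((\<tau>, \<gamma>), (\<tau>2, \<gamma>2)) \<in> toric_glue N"
  shows "((\<tau>1, \<gamma>1), (\<tau>2, \<gamma>2)) \<in> toric_glue N"
proof -
  let ?r = "\<lambda>\<delta> \<tau>. restrict \<delta> (cone_semigroup N \<tau>)"
  note rat = rational[OF \<tau>]
  from 1 obtain \<kappa>1 \<delta>1 where k1: "rational_cone N \<tau>1" "cone_face \<kappa>1 \<tau>1" "cone_face \<kappa>1 \<tau>"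
    "\<delta>1 \<in> affine_points N \<kappa>1" "\<gamma>1 = ?r \<delta>1 \<tau>1" "\<gamma> = ?r \<delta>1 \<tau>" by (rule toric_glueE)
  from 2 obtain \<kappa>2 \<delta>2 where k2: "rational_cone N \<tau>2" "cone_face \<kappa>2 \<tau>" "cone_face \<kappa>2 \<tau>2"
    "\<delta>2 \<in> affine_points N \<kappa>2" "\<gamma> = ?r \<delta>2 \<tau>" "\<gamma>2 = ?r \<delta>2 \<tau>2" by (rule toric_glueE)
  obtain m1 where m1: "cuts_out N \<tau> \<kappa>1 m1" using face_cut[OF \<tau> k1(3)] .
  obtain m2 where m2: "cuts_out N \<tau> \<kappa>2 m2" using face_cut[OF \<tau> k2(2)] .
  have m12: "m1 \<in> cone_semigroup N \<tau>" "m2 \<in> cone_semigroup N \<tau>"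
    using m1 m2 unfolding cuts_out_def by auto
  define \<kappa> where "\<kappa> = \<kappa>1 \<inter> \<kappa>2"
  have m: "cuts_out N \<tau> \<kappa> (m1 + m2)" unfolding \<kappa>_def by (rule cuts_out_Int[OF m1 m2])
  have \<gamma>: "\<gamma> \<in> affine_points N \<tau>"
    unfolding k1(6) using affine_points_restrict[OF cone_face_subset[OF k1(3)] k1(4)] .
  have "\<gamma> m1 \<noteq> 0" using affine_points_cut_nonzero[OF m1 k1(4)] m12 k1(6) by simp
  moreover have "\<gamma> m2 \<noteq> 0" using affine_points_cut_nonzero[OF m2 k2(4)] m12 k2(5) by simp
  ultimately have "\<gamma> (m1 + m2) \<noteq> 0" using affine_points_mult[OF \<gamma> m12] by simp
  then obtain \<delta> where \<delta>: "\<delta> \<in> affine_points N \<kappa>" "?r \<delta> \<tau> = \<gamma>"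
    using extend_point_in[OF rat m \<gamma>] by blast
  have face: "cone_face \<kappa> \<kappa>1" "cone_face \<kappa> \<kappa>2"
  proof -
    have "\<kappa> face_of \<tau>" "\<kappa> \<noteq> {}"
      using face_of_Int k1(3) k2(2) rational_cone_face_0[OF rat k1(3)] rational_cone_face_0[OF rat k2(2)]
      unfolding \<kappa>_def cone_face_def by auto
    then show "cone_face \<kappa> \<kappa>1" "cone_face \<kappa> \<kappa>2"
      using face_of_subset[of \<kappa> \<tau>] cone_face_subset[OF k1(3)] cone_face_subset[OF k2(2)]
      unfolding \<kappa>_def cone_face_def by auto
  qed
  \<comment> \<open>The new extension induces the two given ones: all have the same restriction to
    the middle chart, and restriction is injective.\<close>
  have \<delta>_eq: "?r \<delta> \<kappa>' = \<delta>'"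
    if m': "cuts_out N \<tau> \<kappa>' m'" and \<delta>': "\<delta>' \<in> affine_points N \<kappa>'" "\<gamma> = ?r \<delta>' \<tau>" and f: "cone_face \<kappa> \<kappa>'"
    for \<kappa>' \<delta>' m'
  proof (rule affine_points_eqI[OF rat m' affine_points_restrict[OF cone_face_subset[OF f] \<delta>(1)] \<delta>'(1)])
    show "?r (?r \<delta> \<kappa>') \<tau> = ?r \<delta>' \<tau>"
      by (simp only: restrict_restrict_subset[OF cone_semigroup_antimono[OF cuts_out_subset[OF m']]]
          \<delta>(2) \<delta>'(2)[symmetric])
  qed
  show ?thesis
  proof (rule toric_glueI[OF k1(1) k2(1) _ _ \<delta>(1)])
    show "cone_face \<kappa> \<tau>1" "cone_face \<kappa> \<tau>2"
      using cone_face_trans[OF face(1) k1(2)] cone_face_trans[OF face(2) k2(3)] by auto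
    show "\<gamma>1 = ?r \<delta> \<tau>1"
      by (simp only: k1(5) \<delta>_eq[OF m1 k1(4,6) face(1), symmetric]
          restrict_restrict_subset[OF cone_semigroup_antimono[OF cone_face_subset[OF k1(2)]]])
    show "\<gamma>2 = ?r \<delta> \<tau>2"
      by (simp only: k2(6) \<delta>_eq[OF m2 k2(4,5) face(2), symmetric]
          restrict_restrict_subset[OF cone_semigroup_antimono[OF cone_face_subset[OF k2(3)]]])
  qed
qed

lemma toric_point_eqI:
  assumes "\<tau> \<in> \<Xi>" "\<tau>' \<in> \<Xi>" and g: "((\<tau>, \<gamma>), (\<tau>', \<gamma>')) \<in> toric_glue N"
  shows "toric_point N \<tau> \<gamma> = toric_point N \<tau>' \<gamma>'"
  unfolding toric_point_def
  using toric_glue_trans[OF assms(1) toric_glue_sym[OF g]] toric_glue_trans[OF assms(2) g] by auto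

text \<open>A class contains its own representative by reflexivity, so equality of classes relates
  the representatives.\<close>

lemma toric_point_eqD:
  assumes "\<tau>' \<in> \<Xi>" "\<gamma>' \<in> affine_points N \<tau>'" "toric_point N \<tau> \<gamma> = toric_point N \<tau>' \<gamma>'"
  shows "((\<tau>, \<gamma>), (\<tau>', \<gamma>')) \<in> toric_glue N"
proof -
  have "((\<tau>', \<gamma>'), (\<tau>', \<gamma>')) \<in> toric_glue N"
    using toric_glue_face[OF rational rational rational_cone_face_refl[OF rational] assms(2)] assms(1)
      extensional_restrict[OF affine_points_extensional[OF assms(2)]] by simp
  then have "(\<tau>', \<gamma>') \<in> toric_point N \<tau>' \<gamma>'"
    unfolding toric_point_def by blast
  then have "(\<tau>', \<gamma>') \<in> toric_point N \<tau> \<gamma>"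
    unfolding assms(3) .
  then show ?thesis unfolding toric_point_def by blast
qed

lemma toric_point_face:
  assumes "\<tau> \<in> \<Xi>" "cone_face \<kappa> \<tau>" "\<delta> \<in> affine_points N \<kappa>"
  shows "toric_point N \<kappa> \<delta> = toric_point N \<tau> (restrict \<delta> (cone_semigroup N \<tau>))"
  using assms face_mem rational by (intro toric_point_eqI toric_glue_face) auto

text \<open>Overlaps of charts consist of charts of common faces. Openness in the glued topology
  thereby reduces to openness of face charts inside a single chart.\<close>

lemma chart_preimage:
  assumes \<tau>: "\<tau> \<in> \<Xi>" and \<eta>: "\<eta> \<in> \<Xi>" and B: "B \<subseteq> affine_points N \<eta>"
  shows "{\<gamma> \<in> affine_points N \<tau>. toric_point N \<tau> \<gamma> \<in> toric_point N \<eta> ` B} =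
    (\<Union>\<kappa>\<in>{\<kappa>. cone_face \<kappa> \<tau> \<and> cone_face \<kappa> \<eta>}. (\<lambda>\<delta>. restrict \<delta> (cone_semigroup N \<tau>)) `
       {\<delta> \<in> affine_points N \<kappa>. restrict \<delta> (cone_semigroup N \<eta>) \<in> B})" (is "?L = ?R")
proof
  show "?L \<subseteq> ?R"
  proof
    fix \<gamma> assume "\<gamma> \<in> ?L"
    then obtain \<gamma>' where \<gamma>': "\<gamma>' \<in> B" "toric_point N \<tau> \<gamma> = toric_point N \<eta> \<gamma>'" by blast
    then have "((\<tau>, \<gamma>), (\<eta>, \<gamma>')) \<in> toric_glue N"
      using toric_point_eqD[OF \<eta>] B by blast
    then obtain \<kappa> \<delta> where "cone_face \<kappa> \<tau>" "cone_face \<kappa> \<eta>" "\<delta> \<in> affine_points N \<kappa>"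
      "\<gamma> = restrict \<delta> (cone_semigroup N \<tau>)" "\<gamma>' = restrict \<delta> (cone_semigroup N \<eta>)"
      by (rule toric_glueE)
    then show "\<gamma> \<in> ?R" using \<gamma>'(1) by blast
  qed
  show "?R \<subseteq> ?L"
  proof
    fix \<gamma> assume "\<gamma> \<in> ?R"
    then obtain \<kappa> \<delta> where k: "cone_face \<kappa> \<tau>" "cone_face \<kappa> \<eta>" "\<delta> \<in> affine_points N \<kappa>"
      "\<gamma> = restrict \<delta> (cone_semigroup N \<tau>)" "restrict \<delta> (cone_semigroup N \<eta>) \<in> B" by blast
    then have "toric_point N \<tau> \<gamma> = toric_point N \<eta> (restrict \<delta> (cone_semigroup N \<eta>))"
      using toric_point_face[OF \<tau>] toric_point_face[OF \<eta>] by metis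
    then show "\<gamma> \<in> ?L"
      using k affine_points_restrict[OF cone_face_subset[OF k(1)] k(3)] by blast
  qed
qed

text \<open>The final topology only makes charts continuous; that they are also open maps is what
  reduces the continuity of the contraction to single charts.\<close>

lemma open_chart:
  assumes \<Psi>: "\<Psi> \<subseteq> \<Xi>" and \<eta>: "\<eta> \<in> \<Psi>" and B: "openin (affine_classical N \<eta>) B"
  shows "openin (toric_variety N \<Psi>) (toric_point N \<eta> ` B)"
  unfolding toric_variety_def openin_glued_topology
proof (intro conjI ballI)
  have BU: "B \<subseteq> affine_points N \<eta>" using openin_subset[OF B] topspace_affine_classical by blast
  then show "toric_point N \<eta> ` B \<subseteq> toric_points N \<Psi>"
    using \<eta> unfolding toric_points_def by blast
  fix \<tau> assume "\<tau> \<in> \<Psi>"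
  then have \<tau>: "\<tau> \<in> \<Xi>" using \<Psi> by blast
  have \<eta>': "\<eta> \<in> \<Xi>" using \<Psi> \<eta> by blast
  show "openin (affine_classical N \<tau>) {\<gamma> \<in> affine_points N \<tau>. toric_point N \<tau> \<gamma> \<in> toric_point N \<eta> ` B}"
    unfolding chart_preimage[OF \<tau> \<eta>' BU]
  proof (rule openin_Union, clarify)
    fix \<kappa> assume \<kappa>: "cone_face \<kappa> \<tau>" "cone_face \<kappa> \<eta>"
    obtain m where m: "cuts_out N \<tau> \<kappa> m" using face_cut[OF \<tau> \<kappa>(1)] .
    have "openin (affine_classical N \<kappa>) {\<delta> \<in> affine_points N \<kappa>. restrict \<delta> (cone_semigroup N \<eta>) \<in> B}"
      using openin_continuous_map_preimage[OF continuous_map_affine_restrict[OF cone_face_subset[OF \<kappa>(2)]] B]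
      by (simp add: topspace_affine_classical)
    then show "openin (affine_classical N \<tau>) ((\<lambda>\<delta>. restrict \<delta> (cone_semigroup N \<tau>)) `
       {\<delta> \<in> affine_points N \<kappa>. restrict \<delta> (cone_semigroup N \<eta>) \<in> B})"
      by (rule openin_classical_face[OF rational[OF \<tau>] m])
  qed
qed

text \<open>A point of the chart of \<open>\<tau>\<close> that is glued to a cone of
  \<open>\<Psi>\<close> comes from a common face, and this face belongs to \<open>\<Psi>\<close> by
  closure under faces.\<close>

lemma subfan_preimage:
  assumes \<tau>: "\<tau> \<in> \<Xi>" and \<Psi>: "\<Psi> \<subseteq> \<Xi>" "\<forall>\<eta>\<in>\<Psi>. \<forall>\<kappa>. cone_face \<kappa> \<eta> \<longrightarrow> \<kappa> \<in> \<Psi>"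
  shows "{\<gamma> \<in> affine_points N \<tau>. toric_point N \<tau> \<gamma> \<in> toric_points N \<Psi>} =
    (\<Union>\<kappa>\<in>{\<kappa> \<in> \<Psi>. cone_face \<kappa> \<tau>}. (\<lambda>\<delta>. restrict \<delta> (cone_semigroup N \<tau>)) ` affine_points N \<kappa>)"
    (is "?L = ?R")
proof -
  have "?L = (\<Union>\<eta>\<in>\<Psi>. {\<gamma> \<in> affine_points N \<tau>. toric_point N \<tau> \<gamma> \<in> toric_point N \<eta> ` affine_points N \<eta>})"
    unfolding toric_points_def by blast
  also have "\<dots> = (\<Union>\<eta>\<in>\<Psi>. \<Union>\<kappa>\<in>{\<kappa>. cone_face \<kappa> \<tau> \<and> cone_face \<kappa> \<eta>}.
      (\<lambda>\<delta>. restrict \<delta> (cone_semigroup N \<tau>)) `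
       {\<delta> \<in> affine_points N \<kappa>. restrict \<delta> (cone_semigroup N \<eta>) \<in> affine_points N \<eta>})"
    using chart_preimage[OF \<tau>] \<Psi>(1) by (intro SUP_cong refl) blast
  also have "\<dots> = (\<Union>\<eta>\<in>\<Psi>. \<Union>\<kappa>\<in>{\<kappa>. cone_face \<kappa> \<tau> \<and> cone_face \<kappa> \<eta>}.
      (\<lambda>\<delta>. restrict \<delta> (cone_semigroup N \<tau>)) ` affine_points N \<kappa>)"
    using affine_points_restrict cone_face_subset by (intro SUP_cong arg_cong2[where f = image] refl) blast
  also have "\<dots> = ?R"
    using \<Psi> rational_cone_face_refl[OF rational] by blast
  finally show ?thesis .
qed

text \<open>In each chart the subfan occupies a union of nonvanishing loci of characters, which is
  open in both topologies.\<close>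

lemma subfan_open:
  assumes \<Psi>: "\<Psi> \<subseteq> \<Xi>" "\<forall>\<eta>\<in>\<Psi>. \<forall>\<kappa>. cone_face \<kappa> \<eta> \<longrightarrow> \<kappa> \<in> \<Psi>"
  shows "openin (toric_Zariski N \<Xi>) (toric_points N \<Psi>)"
    and "openin (toric_variety N \<Xi>) (toric_points N \<Psi>)"
proof -
  have sub: "toric_points N \<Psi> \<subseteq> toric_points N \<Xi>"
    using \<Psi>(1) unfolding toric_points_def by blast
  have "openin (affine_Zariski N \<tau>) {\<gamma> \<in> affine_points N \<tau>. toric_point N \<tau> \<gamma> \<in> toric_points N \<Psi>}"
    if \<tau>: "\<tau> \<in> \<Xi>" for \<tau>
    unfolding subfan_preimage[OF \<tau> \<Psi>]
    using face_cut[OF \<tau>] openin_Zariski_face[OF rational[OF \<tau>]] by (intro openin_Union) blast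
  then show "openin (toric_Zariski N \<Xi>) (toric_points N \<Psi>)"
    unfolding toric_Zariski_def openin_glued_topology using sub by blast
  have "openin (affine_classical N \<tau>) {\<gamma> \<in> affine_points N \<tau>. toric_point N \<tau> \<gamma> \<in> toric_points N \<Psi>}"
    if \<tau>: "\<tau> \<in> \<Xi>" for \<tau>
    unfolding subfan_preimage[OF \<tau> \<Psi>]
    using face_cut[OF \<tau>] openin_classical_face[OF rational[OF \<tau>]] openin_topspace[of "affine_classical N _"]
    unfolding topspace_affine_classical by (intro openin_Union) blast
  then show "openin (toric_variety N \<Xi>) (toric_points N \<Psi>)"
    unfolding toric_variety_def openin_glued_topology using sub by blast
qed

end

section \<open>The contraction onto the divisor of a ray\<close>

text \<open>The pairing \<open>m \<bullet> v\<close> is a natural number whenever \<open>v \<in> N\<close> lies in the cone. With a natural exponent,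
  \<open>0 ^ 0 = 1\<close> makes \<open>s = 0\<close> the projection to the divisor.\<close>

definition scale_point ::
    "(real ^ 'n) set \<Rightarrow> real ^ 'n \<Rightarrow> real \<Rightarrow> (real ^ 'n) set \<Rightarrow> (real ^ 'n \<Rightarrow> complex) \<Rightarrow> (real ^ 'n \<Rightarrow> complex)"
  where "scale_point N v s \<tau> \<gamma> = (\<lambda>m\<in>cone_semigroup N \<tau>. of_real s ^ nat \<lfloor>m \<bullet> v\<rfloor> * \<gamma> m)"

lemma dual_pairing_floor: "m \<in> dual_lattice N \<Longrightarrow> v \<in> N \<Longrightarrow> of_int \<lfloor>m \<bullet> v\<rfloor> = m \<bullet> v"
  by (simp add: dual_lattice_def)

lemma cone_pairing_nonneg: "m \<in> cone_semigroup N \<tau> \<Longrightarrow> v \<in> \<tau> \<Longrightarrow> 0 \<le> m \<bullet> v"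
  by (simp add: cone_semigroup_def dual_cone_def)

lemma cone_pairing_nat:
  assumes "m \<in> cone_semigroup N \<tau>" "v \<in> \<tau>" "v \<in> N"
  shows "of_nat (nat \<lfloor>m \<bullet> v\<rfloor>) = m \<bullet> v"
proof -
  have "of_int \<lfloor>m \<bullet> v\<rfloor> = m \<bullet> v"
    using assms dual_pairing_floor unfolding cone_semigroup_def by blast
  then show ?thesis using cone_pairing_nonneg[OF assms(1,2)] by simp
qed

lemma cone_pairing_nat_add:
  assumes "m \<in> cone_semigroup N \<tau>" "m' \<in> cone_semigroup N \<tau>" "v \<in> \<tau>" "v \<in> N"
  shows "nat \<lfloor>(m + m') \<bullet> v\<rfloor> = nat \<lfloor>m \<bullet> v\<rfloor> + nat \<lfloor>m' \<bullet> v\<rfloor>"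
proof -
  have "real (nat \<lfloor>(m + m') \<bullet> v\<rfloor>) = real (nat \<lfloor>m \<bullet> v\<rfloor> + nat \<lfloor>m' \<bullet> v\<rfloor>)"
    using cone_pairing_nat[OF assms(1,3,4)] cone_pairing_nat[OF assms(2,3,4)]
      cone_pairing_nat[OF cone_semigroup_add[OF assms(1,2)] assms(3,4)]
    by (simp only: of_nat_add inner_add_left)
  then show ?thesis by (simp only: of_nat_eq_iff)
qed

lemma scale_point_in:
  assumes "v \<in> \<tau>" "v \<in> N" "\<gamma> \<in> affine_points N \<tau>"
  shows "scale_point N v s \<tau> \<gamma> \<in> affine_points N \<tau>"
  using cone_pairing_nat_add[OF _ _ assms(1,2)] affine_points_mult[OF assms(3)] affine_points_1[OF assms(3)]
  by (auto simp: affine_points_def scale_point_def cone_semigroup_0 cone_semigroup_add power_add)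

lemma scale_point_restrict:
  assumes "\<kappa> \<subseteq> \<tau>"
  shows "restrict (scale_point N v s \<kappa> \<delta>) (cone_semigroup N \<tau>) =
    scale_point N v s \<tau> (restrict \<delta> (cone_semigroup N \<tau>))"
  using cone_semigroup_antimono[OF assms] by (auto simp: scale_point_def restrict_def fun_eq_iff)

lemma continuous_map_scale_point:
  assumes "v \<in> \<tau>" "v \<in> N"
  shows "continuous_map (prod_topology (top_of_set {0..1}) (affine_classical N \<tau>)) (affine_classical N \<tau>)
    (\<lambda>(t, \<gamma>). scale_point N v (1 - t) \<tau> \<gamma>)"
  unfolding continuous_map_affine_classical
proof (intro conjI ballI)
  let ?X = "prod_topology (top_of_set {0..1::real}) (affine_classical N \<tau>)"
  show "(\<lambda>(t, \<gamma>). scale_point N v (1 - t) \<tau> \<gamma>) ` topspace ?X \<subseteq> affine_points N \<tau>"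
    using scale_point_in[OF assms] by (auto simp: topspace_affine_classical)
  fix m assume m: "m \<in> cone_semigroup N \<tau>"
  have "continuous_map (top_of_set {0..1::real}) euclidean (\<lambda>t. complex_of_real (1 - t))"
    by (auto intro!: continuous_intros)
  from continuous_map_of_fst[THEN iffD2, OF disjI2, OF this]
  have "continuous_map ?X euclidean (\<lambda>p. complex_of_real (1 - fst p))"
    by (simp add: o_def)
  moreover have "continuous_map ?X euclidean (\<lambda>p. snd p m)"
    using continuous_map_compose[OF continuous_map_snd continuous_map_affine_eval[OF m]]
    by (simp add: o_def)
  ultimately have "continuous_map ?X euclidean
      (\<lambda>p. complex_of_real (1 - fst p) ^ nat \<lfloor>m \<bullet> v\<rfloor> * snd p m)"
    by (intro continuous_map_mult continuous_map_power)
  then show "continuous_map ?X euclidean (\<lambda>p. (case p of (t, \<gamma>) \<Rightarrow> scale_point N v (1 - t) \<tau> \<gamma>) m)"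
    using m by (simp add: scale_point_def case_prod_unfold)
qed

text \<open>The equations of the divisor of the ray in one chart. The condition
  \<open>v \<in> \<tau>\<close> keeps out the torus-fixed point of a full-dimensional cone away from
  \<open>v\<close>: every nonzero character vanishes at that point.\<close>

definition vanishing :: "(real ^ 'n) set \<Rightarrow> real ^ 'n \<Rightarrow> (real ^ 'n) set \<Rightarrow> (real ^ 'n \<Rightarrow> complex) \<Rightarrow> bool" where
  "vanishing N v \<tau> \<gamma> \<longleftrightarrow> v \<in> \<tau> \<and> (\<forall>m\<in>cone_semigroup N \<tau>. m \<bullet> v \<noteq> 0 \<longrightarrow> \<gamma> m = 0)"

definition ray_divisor :: "(real ^ 'n) set \<Rightarrow> (real ^ 'n) set set \<Rightarrow> real ^ 'n \<Rightarrow> 'n toric_point set" where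
  "ray_divisor N \<Xi> v = {toric_point N \<tau> \<gamma> | \<tau> \<gamma>. \<tau> \<in> \<Xi> \<and> \<gamma> \<in> affine_points N \<tau> \<and> vanishing N v \<tau> \<gamma>}"

lemma vanishing_restrict:
  "vanishing N v \<kappa> \<delta> \<Longrightarrow> \<kappa> \<subseteq> \<tau> \<Longrightarrow> vanishing N v \<tau> (restrict \<delta> (cone_semigroup N \<tau>))"
  using cone_semigroup_antimono[of \<kappa> \<tau> N] unfolding vanishing_def by auto

lemma vanishing_scale_fixed:
  assumes "vanishing N v \<tau> \<gamma>" "\<gamma> \<in> affine_points N \<tau>"
  shows "scale_point N v s \<tau> \<gamma> = \<gamma>"
proof (rule extensionalityI[OF _ affine_points_extensional[OF assms(2)]])
  show "scale_point N v s \<tau> \<gamma> \<in> extensional (cone_semigroup N \<tau>)" by (simp add: scale_point_def)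
  fix m assume "m \<in> cone_semigroup N \<tau>"
  \<comment> \<open>A character orthogonal to \<open>v\<close> gets the factor
    \<open>s ^ 0 = 1\<close>; any other has value 0 already.\<close>
  then show "scale_point N v s \<tau> \<gamma> m = \<gamma> m"
    using assms(1) unfolding scale_point_def vanishing_def by (cases "m \<bullet> v = 0") auto
qed

lemma vanishing_scale_0:
  assumes "v \<in> \<tau>" "v \<in> N"
  shows "vanishing N v \<tau> (scale_point N v 0 \<tau> \<gamma>)"
  unfolding vanishing_def
proof (intro conjI ballI impI assms(1))
  fix m assume m: "m \<in> cone_semigroup N \<tau>" "m \<bullet> v \<noteq> 0"
  then have "nat \<lfloor>m \<bullet> v\<rfloor> \<noteq> 0" using cone_pairing_nat[OF m(1) assms] by (metis of_nat_0)
  then show "scale_point N v 0 \<tau> \<gamma> m = 0" using m(1) by (simp add: scale_point_def)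
qed

context smooth_toric_fan
begin

lemma glue_scale:
  assumes \<tau>: "\<tau> \<in> \<Xi>" "\<tau>' \<in> \<Xi>" and v: "v \<in> \<tau>" "v \<in> \<tau>'" "v \<in> N"
    and g: "((\<tau>, \<gamma>), (\<tau>', \<gamma>')) \<in> toric_glue N"
  shows "((\<tau>, scale_point N v s \<tau> \<gamma>), (\<tau>', scale_point N v s \<tau>' \<gamma>')) \<in> toric_glue N"
proof -
  let ?r = "\<lambda>\<delta> \<tau>. restrict \<delta> (cone_semigroup N \<tau>)"
  from g obtain \<kappa> \<delta> where k: "cone_face \<kappa> \<tau>" "cone_face \<kappa> \<tau>'" "\<delta> \<in> affine_points N \<kappa>"
    "\<gamma> = ?r \<delta> \<tau>" "\<gamma>' = ?r \<delta> \<tau>'" by (rule toric_glueE)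
  \<comment> \<open>The common face carrying the point need not contain \<open>v\<close>, but the larger face \<open>\<tau> \<inter> \<tau>'\<close> does.\<close>
  define \<mu> where "\<mu> = \<tau> \<inter> \<tau>'"
  have \<mu>: "cone_face \<mu> \<tau>" "cone_face \<mu> \<tau>'" "\<kappa> \<subseteq> \<mu>" "v \<in> \<mu>"
    using face_Int[OF \<tau>] cone_face_subset[OF k(1)] cone_face_subset[OF k(2)] v by (auto simp: \<mu>_def)
  note sub = cone_face_subset[OF \<mu>(1)] cone_face_subset[OF \<mu>(2)]
  have rr: "?r (?r \<delta> \<mu>) \<tau> = \<gamma>" "?r (?r \<delta> \<mu>) \<tau>' = \<gamma>'"
    by (simp_all only: k(4,5) restrict_restrict_subset[OF cone_semigroup_antimono[OF sub(1)]]
        restrict_restrict_subset[OF cone_semigroup_antimono[OF sub(2)]])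
  show ?thesis
  proof (rule toric_glueI[OF rational[OF \<tau>(1)] rational[OF \<tau>(2)] \<mu>(1,2)])
    show "scale_point N v s \<mu> (?r \<delta> \<mu>) \<in> affine_points N \<mu>"
      by (rule scale_point_in[OF \<mu>(4) v(3) affine_points_restrict[OF \<mu>(3) k(3)]])
  qed (simp_all only: scale_point_restrict[OF sub(1)] scale_point_restrict[OF sub(2)] rr)
qed

text \<open>The character \<open>m0\<close> cutting out the gluing face is nonzero at the point, so
  the equations force it to be orthogonal to \<open>v\<close>, and \<open>v\<close> lies in that
  face. Adding multiples of \<open>m0\<close> moves a character of the face into the semigroup of
  \<open>\<tau>\<close> without changing its pairing with \<open>v\<close>, so the equations pass to
  the face and from there to \<open>\<tau>'\<close>.\<close>

lemma glue_vanishing: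
  assumes \<tau>: "\<tau> \<in> \<Xi>" and g: "((\<tau>, \<gamma>), (\<tau>', \<gamma>')) \<in> toric_glue N" and van: "vanishing N v \<tau> \<gamma>"
  shows "vanishing N v \<tau>' \<gamma>'"
proof -
  from g obtain \<kappa> \<delta> where k: "cone_face \<kappa> \<tau>" "cone_face \<kappa> \<tau>'" "\<delta> \<in> affine_points N \<kappa>"
    "\<gamma> = restrict \<delta> (cone_semigroup N \<tau>)" "\<gamma>' = restrict \<delta> (cone_semigroup N \<tau>')"
    by (rule toric_glueE)
  obtain m0 where m0: "cuts_out N \<tau> \<kappa> m0" using face_cut[OF \<tau> k(1)] .
  have m0\<tau>: "m0 \<in> cone_semigroup N \<tau>" using m0 unfolding cuts_out_def by blast
  have nz: "\<delta> m0 \<noteq> 0" by (rule affine_points_cut_nonzero[OF m0 k(3)])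
  have "m0 \<bullet> v = 0"
    using nz m0\<tau> van k(4) unfolding vanishing_def by auto
  then have v\<kappa>: "v \<in> \<kappa>" using m0 van unfolding cuts_out_def vanishing_def by blast
  have "\<delta> m = 0" if m: "m \<in> cone_semigroup N \<kappa>" "m \<bullet> v \<noteq> 0" for m
  proof -
    obtain k' :: nat where k': "m + of_nat k' *\<^sub>R m0 \<in> cone_semigroup N \<tau>"
      using cuts_out_shift[OF rational[OF \<tau>] m0 m(1)] by blast
    have "(m + of_nat k' *\<^sub>R m0) \<bullet> v \<noteq> 0"
      using m(2) \<open>m0 \<bullet> v = 0\<close> by (simp add: inner_add_left)
    then have "\<gamma> (m + of_nat k' *\<^sub>R m0) = 0" using k' van unfolding vanishing_def by blast
    then show ?thesis
      using affine_points_shift[OF m0 k(3) m(1), of k'] k' k(4) by simp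
  qed
  then have "vanishing N v \<kappa> \<delta>" using v\<kappa> unfolding vanishing_def by blast
  then show ?thesis unfolding k(5) using vanishing_restrict cone_face_subset[OF k(2)] by blast
qed

lemma ray_divisor_iff:
  assumes "\<tau> \<in> \<Xi>" "\<gamma> \<in> affine_points N \<tau>"
  shows "toric_point N \<tau> \<gamma> \<in> ray_divisor N \<Xi> v \<longleftrightarrow> vanishing N v \<tau> \<gamma>"
proof
  assume "toric_point N \<tau> \<gamma> \<in> ray_divisor N \<Xi> v"
  then obtain \<tau>' \<gamma>' where *: "\<tau>' \<in> \<Xi>" "\<gamma>' \<in> affine_points N \<tau>'" "vanishing N v \<tau>' \<gamma>'"
    "toric_point N \<tau> \<gamma> = toric_point N \<tau>' \<gamma>'" unfolding ray_divisor_def by blast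
  show "vanishing N v \<tau> \<gamma>"
    using glue_vanishing[OF *(1) toric_glue_sym[OF toric_point_eqD[OF *(1,2,4)]] *(3)] .
qed (use assms in \<open>auto simp: ray_divisor_def\<close>)

text \<open>In a chart whose cone contains \<open>v\<close> the divisor is an intersection of zero
  loci of characters; the other charts miss it.\<close>

lemma closedin_ray_divisor: "closedin (toric_variety N \<Xi>) (ray_divisor N \<Xi> v)"
  unfolding closedin_def topspace_toric_variety
proof
  show "ray_divisor N \<Xi> v \<subseteq> toric_points N \<Xi>"
    unfolding ray_divisor_def toric_points_def by blast
  show "openin (toric_variety N \<Xi>) (toric_points N \<Xi> - ray_divisor N \<Xi> v)"
    unfolding toric_variety_def openin_glued_topology
  proof (intro conjI ballI)
    fix \<tau> assume \<tau>: "\<tau> \<in> \<Xi>"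
    have eq: "{\<gamma> \<in> affine_points N \<tau>. toric_point N \<tau> \<gamma> \<in> toric_points N \<Xi> - ray_divisor N \<Xi> v} =
       {\<gamma> \<in> affine_points N \<tau>. \<not> vanishing N v \<tau> \<gamma>}"
      using ray_divisor_iff[OF \<tau>] \<tau> unfolding toric_points_def by blast
    show "openin (affine_classical N \<tau>)
        {\<gamma> \<in> affine_points N \<tau>. toric_point N \<tau> \<gamma> \<in> toric_points N \<Xi> - ray_divisor N \<Xi> v}"
    proof (cases "v \<in> \<tau>")
      case True
      have "openin (affine_classical N \<tau>) {\<gamma> \<in> topspace (affine_classical N \<tau>). \<gamma> m \<in> - {0}}"
        if "m \<in> cone_semigroup N \<tau>" for m
        by (rule openin_continuous_map_preimage[OF continuous_map_affine_eval[OF that]]) auto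
      then have "openin (affine_classical N \<tau>)
         (\<Union>m\<in>{m \<in> cone_semigroup N \<tau>. m \<bullet> v \<noteq> 0}. {\<gamma> \<in> topspace (affine_classical N \<tau>). \<gamma> m \<in> - {0}})"
        by (intro openin_Union) blast
      also have "(\<Union>m\<in>{m \<in> cone_semigroup N \<tau>. m \<bullet> v \<noteq> 0}.
          {\<gamma> \<in> topspace (affine_classical N \<tau>). \<gamma> m \<in> - {0}}) =
         {\<gamma> \<in> affine_points N \<tau>. \<not> vanishing N v \<tau> \<gamma>}"
        using True by (auto simp: vanishing_def topspace_affine_classical)
      finally show ?thesis unfolding eq .
    next
      case False
      then have "{\<gamma> \<in> affine_points N \<tau>. \<not> vanishing N v \<tau> \<gamma>} = topspace (affine_classical N \<tau>)"
        by (auto simp: vanishing_def topspace_affine_classical)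
      then show ?thesis unfolding eq by simp
    qed
  qed blast
qed

text \<open>The scaling on classes, computed in any chart whose cone contains \<open>v\<close>;
  \<open>glue_scale\<close> makes the result independent of the chart. A point without such a chart
  gets an unspecified value.\<close>

definition scale_map :: "real ^ 'n \<Rightarrow> real \<Rightarrow> 'n toric_point \<Rightarrow> 'n toric_point" where
  "scale_map v s x = (SOME y. \<exists>\<tau>\<in>\<Xi>. v \<in> \<tau> \<and> (\<exists>\<gamma>\<in>affine_points N \<tau>.
     x = toric_point N \<tau> \<gamma> \<and> y = toric_point N \<tau> (scale_point N v s \<tau> \<gamma>)))"

lemma scale_map_eq:
  assumes "v \<in> N" "\<tau> \<in> \<Xi>" "v \<in> \<tau>" "\<gamma> \<in> affine_points N \<tau>"
  shows "scale_map v s (toric_point N \<tau> \<gamma>) = toric_point N \<tau> (scale_point N v s \<tau> \<gamma>)"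
  unfolding scale_map_def
proof (rule some_equality)
  fix y assume "\<exists>\<tau>'\<in>\<Xi>. v \<in> \<tau>' \<and> (\<exists>\<gamma>'\<in>affine_points N \<tau>'.
     toric_point N \<tau> \<gamma> = toric_point N \<tau>' \<gamma>' \<and> y = toric_point N \<tau>' (scale_point N v s \<tau>' \<gamma>'))"
  then obtain \<tau>' \<gamma>' where *: "\<tau>' \<in> \<Xi>" "v \<in> \<tau>'" "\<gamma>' \<in> affine_points N \<tau>'"
    "toric_point N \<tau> \<gamma> = toric_point N \<tau>' \<gamma>'" "y = toric_point N \<tau>' (scale_point N v s \<tau>' \<gamma>')" by blast
  show "y = toric_point N \<tau> (scale_point N v s \<tau> \<gamma>)"
    unfolding *(5) using toric_point_eqD[OF *(1,3,4)] assms *(1,2)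
    by (intro toric_point_eqI[symmetric] glue_scale)
qed (use assms in blast)

text \<open>The hypothesis on \<open>\<Psi>\<close> lets every representative be moved, by
  restriction, to a larger chart on which the scaling is defined.\<close>

lemma toric_points_cover:
  assumes "\<Psi> \<subseteq> \<Xi>" "\<forall>\<tau>\<in>\<Psi>. \<exists>\<eta>\<in>\<Psi>. v \<in> \<eta> \<and> cone_face \<tau> \<eta>" "x \<in> toric_points N \<Psi>"
  obtains \<eta> \<gamma> where "\<eta> \<in> \<Psi>" "v \<in> \<eta>" "\<gamma> \<in> affine_points N \<eta>" "x = toric_point N \<eta> \<gamma>"
proof -
  obtain \<tau> \<gamma> where *: "\<tau> \<in> \<Psi>" "\<gamma> \<in> affine_points N \<tau>" "x = toric_point N \<tau> \<gamma>"
    using assms(3) unfolding toric_points_def by blast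
  then obtain \<eta> where \<eta>: "\<eta> \<in> \<Psi>" "v \<in> \<eta>" "cone_face \<tau> \<eta>" using assms(2) by blast
  show ?thesis
    using that[OF \<eta>(1,2) affine_points_restrict[OF cone_face_subset[OF \<eta>(3)] *(2)]]
      toric_point_face[OF _ \<eta>(3) *(2)] \<eta>(1) assms(1) *(3) by blast
qed

text \<open>Continuity is checked at one point of the product. In a chart around it the scaling is
  jointly continuous, which yields a box \<open>A \<times> B\<close> inside the preimage; as the
  chart is an open map, the image of \<open>B\<close> is a neighbourhood in the glued
  variety.\<close>

lemma continuous_map_scale_map:
  assumes v: "v \<in> N" and \<Psi>: "\<Psi> \<subseteq> \<Xi>" "\<forall>\<tau>\<in>\<Psi>. \<exists>\<eta>\<in>\<Psi>. v \<in> \<eta> \<and> cone_face \<tau> \<eta>"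
  shows "continuous_map (prod_topology (top_of_set {0..1}) (toric_variety N \<Psi>)) (toric_variety N \<Psi>)
    (\<lambda>(t, x). scale_map v (1 - t) x)"
  unfolding continuous_map_def
proof (intro conjI allI impI)
  let ?X = "toric_variety N \<Psi>" and ?I = "top_of_set {0..1::real}"
  have chart: "scale_map v s (toric_point N \<eta> \<gamma>) = toric_point N \<eta> (scale_point N v s \<eta> \<gamma>)"
    if "\<eta> \<in> \<Psi>" "v \<in> \<eta>" "\<gamma> \<in> affine_points N \<eta>" for \<eta> \<gamma> s
    using scale_map_eq[OF v] that \<Psi>(1) by blast
  have in_X: "toric_point N \<eta> \<gamma> \<in> toric_points N \<Psi>" if "\<eta> \<in> \<Psi>" "\<gamma> \<in> affine_points N \<eta>" for \<eta> \<gamma>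
    using that unfolding toric_points_def by blast
  show "(\<lambda>(t, x). scale_map v (1 - t) x) \<in> topspace (prod_topology ?I ?X) \<rightarrow> topspace ?X"
  proof (clarsimp simp: topspace_toric_variety)
    fix t x assume "x \<in> toric_points N \<Psi>"
    then obtain \<eta> \<gamma> where "\<eta> \<in> \<Psi>" "v \<in> \<eta>" "\<gamma> \<in> affine_points N \<eta>" "x = toric_point N \<eta> \<gamma>"
      using toric_points_cover[OF \<Psi>] by metis
    then show "scale_map v (1 - t) x \<in> toric_points N \<Psi>"
      using chart in_X scale_point_in[OF _ v] by simp
  qed
  fix W assume W: "openin ?X W"
  show "openin (prod_topology ?I ?X)
     {p \<in> topspace (prod_topology ?I ?X). (case p of (t, x) \<Rightarrow> scale_map v (1 - t) x) \<in> W}"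
    unfolding openin_prod_topology_alt
  proof (intro allI impI)
    fix t x
    assume "(t, x) \<in> {p \<in> topspace (prod_topology ?I ?X). (case p of (t, x) \<Rightarrow> scale_map v (1 - t) x) \<in> W}"
    then have tx: "t \<in> {0..1}" "x \<in> toric_points N \<Psi>" "scale_map v (1 - t) x \<in> W"
      by (auto simp: topspace_toric_variety)
    then obtain \<eta> \<gamma> where \<eta>: "\<eta> \<in> \<Psi>" "v \<in> \<eta>" "\<gamma> \<in> affine_points N \<eta>" "x = toric_point N \<eta> \<gamma>"
      using toric_points_cover[OF \<Psi>] by metis
    define V where "V = {\<gamma> \<in> affine_points N \<eta>. toric_point N \<eta> \<gamma> \<in> W}"
    define P where "P = {p \<in> topspace (prod_topology ?I (affine_classical N \<eta>)).
        (case p of (t, \<gamma>) \<Rightarrow> scale_point N v (1 - t) \<eta> \<gamma>) \<in> V}"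
    have "openin (affine_classical N \<eta>) V"
      using W \<eta>(1) unfolding toric_variety_def openin_glued_topology V_def by blast
    then have "openin (prod_topology ?I (affine_classical N \<eta>)) P"
      unfolding P_def by (rule openin_continuous_map_preimage[OF continuous_map_scale_point[OF \<eta>(2) v]])
    moreover have "(t, \<gamma>) \<in> P"
      using tx \<eta> chart scale_point_in[OF \<eta>(2) v \<eta>(3)]
      by (simp add: P_def V_def topspace_affine_classical)
    ultimately have "\<exists>A B. openin ?I A \<and> openin (affine_classical N \<eta>) B \<and> t \<in> A \<and> \<gamma> \<in> B \<and> A \<times> B \<subseteq> P"
      by (rule openin_prod_topology_alt[THEN iffD1, THEN spec, THEN spec, THEN mp])
    then obtain A B where AB: "openin ?I A" "openin (affine_classical N \<eta>) B" "t \<in> A" "\<gamma> \<in> B"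
      "A \<times> B \<subseteq> P" by blast
    have "openin ?X (toric_point N \<eta> ` B)" by (rule open_chart[OF \<Psi>(1) \<eta>(1) AB(2)])
    moreover have "x \<in> toric_point N \<eta> ` B" using \<eta>(4) AB(4) by blast
    moreover have "A \<times> toric_point N \<eta> ` B \<subseteq>
        {p \<in> topspace (prod_topology ?I ?X). (case p of (t, x) \<Rightarrow> scale_map v (1 - t) x) \<in> W}"
    proof
      fix p assume "p \<in> A \<times> toric_point N \<eta> ` B"
      then obtain t' \<gamma>' where p: "p = (t', toric_point N \<eta> \<gamma>')" "t' \<in> A" "\<gamma>' \<in> B"
        by (elim SigmaE imageE) simp
      then have "(t', \<gamma>') \<in> P" using AB(5) by blast
      then have t': "t' \<in> {0..1}" and \<gamma>': "\<gamma>' \<in> affine_points N \<eta>"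
        and W': "toric_point N \<eta> (scale_point N v (1 - t') \<eta> \<gamma>') \<in> W"
        unfolding P_def V_def by (simp_all add: topspace_affine_classical)
      show "p \<in> {p \<in> topspace (prod_topology ?I ?X). (case p of (t, x) \<Rightarrow> scale_map v (1 - t) x) \<in> W}"
        using t' W' in_X[OF \<eta>(1) \<gamma>'] unfolding p(1)
        by (simp add: topspace_toric_variety chart[OF \<eta>(1,2) \<gamma>'])
    qed
    ultimately show "\<exists>U V. openin ?I U \<and> openin ?X V \<and> t \<in> U \<and> x \<in> V \<and> U \<times> V \<subseteq>
        {p \<in> topspace (prod_topology ?I ?X). (case p of (t, x) \<Rightarrow> scale_map v (1 - t) x) \<in> W}"
      using AB(1,3) by blast
  qed
qed

lemma deformation_retract_ray_divisor:
  assumes v: "v \<in> N" and \<Psi>: "\<Psi> \<subseteq> \<Xi>" "\<forall>\<tau>\<in>\<Psi>. \<exists>\<eta>\<in>\<Psi>. v \<in> \<eta> \<and> cone_face \<tau> \<eta>"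
    and sub: "ray_divisor N \<Xi> v \<subseteq> toric_points N \<Psi>"
  shows "deformation_retract_of (ray_divisor N \<Xi> v) (toric_variety N \<Psi>)"
proof -
  \<comment> \<open>\<open>homotopic_with\<close> asks for \<open>h (0, x) = x\<close> at every
    \<open>x\<close> of the type, hence the identity off the variety. The factor
    \<open>1 - t\<close> starts at the identity and ends at the projection.\<close>
  define h where "h = (\<lambda>(t, x). if x \<in> toric_points N \<Psi> then scale_map v (1 - t) x else x)"
  have "continuous_map (prod_topology (top_of_set {0..1}) (toric_variety N \<Psi>)) (toric_variety N \<Psi>) h"
    by (rule continuous_map_eq[OF continuous_map_scale_map[OF v \<Psi>]])
      (auto simp: h_def topspace_toric_variety)
  moreover have "h (0, x) = x" for x
  proof (cases "x \<in> toric_points N \<Psi>")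
    case True
    then obtain \<eta> \<gamma> where \<eta>: "\<eta> \<in> \<Psi>" "v \<in> \<eta>" "\<gamma> \<in> affine_points N \<eta>" "x = toric_point N \<eta> \<gamma>"
      using toric_points_cover[OF \<Psi>] by metis
    moreover have "scale_point N v 1 \<eta> \<gamma> = \<gamma>"
      using affine_points_extensional[OF \<eta>(3)] by (simp add: scale_point_def extensional_restrict)
    ultimately show ?thesis
      using scale_map_eq[OF v] \<Psi>(1) True by (auto simp: h_def)
  qed (simp add: h_def)
  moreover have "h (t, x) = x" if "x \<in> ray_divisor N \<Xi> v" for t x
  proof -
    from that obtain \<tau> \<gamma> where *: "\<tau> \<in> \<Xi>" "\<gamma> \<in> affine_points N \<tau>" "vanishing N v \<tau> \<gamma>"
      "x = toric_point N \<tau> \<gamma>" unfolding ray_divisor_def by blast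
    have "v \<in> \<tau>" using *(3) unfolding vanishing_def by blast
    have "scale_map v (1 - t) x = x"
      unfolding *(4) scale_map_eq[OF v *(1) \<open>v \<in> \<tau>\<close> *(2)] vanishing_scale_fixed[OF *(3,2)] ..
    then show ?thesis by (simp add: h_def)
  qed
  moreover have "h (1, x) \<in> ray_divisor N \<Xi> v" if x: "x \<in> toric_points N \<Psi>" for x
  proof -
    obtain \<eta> \<gamma> where \<eta>: "\<eta> \<in> \<Psi>" "v \<in> \<eta>" "\<gamma> \<in> affine_points N \<eta>" "x = toric_point N \<eta> \<gamma>"
      using toric_points_cover[OF \<Psi> x] by metis
    then show ?thesis
      using scale_map_eq[OF v] \<Psi>(1) x ray_divisor_iff scale_point_in[OF \<eta>(2) v \<eta>(3)]
        vanishing_scale_0[OF \<eta>(2) v] by (auto simp: h_def)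
  qed
  ultimately show ?thesis
    unfolding deformation_retract_of_def homotopic_with_def topspace_toric_variety
    using sub by (intro conjI exI[of _ "\<lambda>x. h (1, x)"] exI[of _ h]) auto
qed

end

section \<open>The closure of the orbit of a ray\<close>

lemma dim_convex_cone_hull: "dim (convex_cone hull S :: 'a::euclidean_space set) = dim S"
proof -
  have "convex_cone hull S \<subseteq> span S"
    by (intro hull_minimal span_superset convex_cone_span)
  then have "span (convex_cone hull S) = span S"
    by (metis hull_subset span_mono span_span subset_antisym)
  then show ?thesis by (metis dim_span)
qed

text \<open>The generators span the whole space, and a spanning subset of an independent set is all
  of it.\<close>

lemma (in smooth_toric_fan) full_dim_smooth_cone:
  assumes "\<eta> \<in> \<Xi>" "dim \<eta> = CARD('n)"
  obtains B where "lattice_basis N B" "\<eta> = convex_cone hull B" "span B = UNIV"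
proof -
  obtain B S where B: "lattice_basis N B" "S \<subseteq> B" "\<eta> = convex_cone hull S"
    using smooth_cone[OF assms(1)] .
  have indep: "independent B" using B(1) unfolding lattice_basis_def by blast
  have "dim S = DIM(real ^ 'n)"
    using assms(2) unfolding B(3) dim_convex_cone_hull by simp
  then have S: "span S = UNIV" by (simp only: dim_eq_full)
  then have "S = B" using spanning_subset_independent[OF B(2) indep] by simp
  then show ?thesis using that B S by blast
qed

text \<open>The interior of the support, minus the closed union \<open>F\<close> of the
  full-dimensional cones, is open and covered by negligible cones, hence empty. A convex set with
  interior lies in the closure of its interior, so \<open>F\<close> contains the whole support, in
  particular a relative interior point \<open>x\<close> of \<open>\<tau>\<close>.\<close>

lemma (in smooth_toric_fan) in_full_dim_cone:
  assumes conv: "convex (\<Union>\<Xi>)" and int: "interior (\<Union>\<Xi>) \<noteq> {}" and \<tau>: "\<tau> \<in> \<Xi>"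
  shows "\<exists>\<eta>\<in>\<Xi>. dim \<eta> = CARD('n) \<and> cone_face \<tau> \<eta>"
proof -
  have cone: "\<exists>S. finite S \<and> \<eta> = convex_cone hull S" if "\<eta> \<in> \<Xi>" for \<eta>
    using rational[OF that] unfolding rational_cone_def by blast
  have "convex \<tau>" "\<tau> \<noteq> {}"
    using cone[OF \<tau>] convex_convex_cone_hull convex_cone_hull_nonempty by auto
  then obtain x where x: "x \<in> rel_interior \<tau>" using rel_interior_eq_empty by blast
  define F where "F = \<Union>{\<eta> \<in> \<Xi>. dim \<eta> = CARD('n)}"
  have "closed F"
    unfolding F_def
  proof (rule closed_Union)
    show "finite {\<eta> \<in> \<Xi>. dim \<eta> = CARD('n)}" using finite_fan by simp
    show "\<forall>\<eta>\<in>{\<eta> \<in> \<Xi>. dim \<eta> = CARD('n)}. closed \<eta>"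
    proof
      fix \<eta> assume "\<eta> \<in> {\<eta> \<in> \<Xi>. dim \<eta> = CARD('n)}"
      then obtain S where "finite S" "\<eta> = convex_cone hull S" using cone by blast
      then show "closed \<eta>" using closed_convex_cone_hull by simp
    qed
  qed
  have "negligible (\<Union>{\<eta> \<in> \<Xi>. dim \<eta> < CARD('n)})"
  proof (rule negligible_Union)
    show "finite {\<eta> \<in> \<Xi>. dim \<eta> < CARD('n)}" using finite_fan by simp
    show "negligible \<eta>" if "\<eta> \<in> {\<eta> \<in> \<Xi>. dim \<eta> < CARD('n)}" for \<eta>
      using that by (intro negligible_lowdim) simp
  qed
  moreover have "interior (\<Union>\<Xi>) \<inter> - F \<subseteq> \<Union>{\<eta> \<in> \<Xi>. dim \<eta> < CARD('n)}"
  proof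
    fix y assume y: "y \<in> interior (\<Union>\<Xi>) \<inter> - F"
    then obtain \<eta> where "\<eta> \<in> \<Xi>" "y \<in> \<eta>" using interior_subset by blast
    moreover from this y have "dim \<eta> \<noteq> CARD('n)" unfolding F_def by blast
    moreover have "dim \<eta> \<le> CARD('n)" using dim_subset_UNIV[of \<eta>] by simp
    ultimately show "y \<in> \<Union>{\<eta> \<in> \<Xi>. dim \<eta> < CARD('n)}" by auto
  qed
  ultimately have "negligible (interior (\<Union>\<Xi>) \<inter> - F)" by (rule negligible_subset)
  then have empty: "interior (\<Union>\<Xi>) \<inter> - F = {}"
    using open_not_negligible \<open>closed F\<close> by (metis open_Compl open_Int open_interior)
  have "x \<in> closure (\<Union>\<Xi>)"
    using x \<tau> rel_interior_subset closure_subset by blast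
  then have "x \<in> closure (interior (\<Union>\<Xi>))" by (simp only: convex_closure_interior[OF conv int])
  then have "x \<in> F" using empty closure_minimal[OF _ \<open>closed F\<close>] by blast
  then obtain \<eta> where \<eta>: "\<eta> \<in> \<Xi>" "dim \<eta> = CARD('n)" "x \<in> \<eta>" unfolding F_def by blast
  have faces: "cone_face (\<tau> \<inter> \<eta>) \<tau>" "cone_face (\<tau> \<inter> \<eta>) \<eta>" using face_Int[OF \<tau> \<eta>(1)] by auto
  have "x \<in> \<tau>" using x rel_interior_subset by blast
  \<comment> \<open>A face of \<open>\<tau>\<close> that meets the relative interior of
    \<open>\<tau>\<close> is all of \<open>\<tau>\<close>.\<close>
  then have "\<tau> \<subseteq> \<tau> \<inter> \<eta>"
    using faces(1) x \<eta>(3) subset_of_face_of[of "\<tau> \<inter> \<eta>" \<tau> \<tau>] unfolding cone_face_def by blast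
  then have "\<tau> \<inter> \<eta> = \<tau>" by blast
  then show ?thesis using \<eta> faces(2) by auto
qed

section \<open>The orbit of a ray and its limit points\<close>

lemma ray_eq: "convex_cone hull {v} = {c *\<^sub>R v | c. 0 \<le> c}"
  using convex_cone_hull_finite[of "{v}"] by auto

lemma ray_mem: "v \<in> convex_cone hull {v}"
  by (simp add: hull_inc)

lemma ray_orthogonal: "(\<forall>u\<in>convex_cone hull {v}. m \<bullet> u = 0) \<longleftrightarrow> m \<bullet> v = 0"
  using ray_mem[of v] by (auto simp: ray_eq)

text \<open>An orbit point agrees with \<open>t\<close> on the characters orthogonal to
  \<open>v\<close> and vanishes elsewhere. This is multiplicative since pairings with
  \<open>v\<close> are nonnegative: a sum is orthogonal to \<open>v\<close> only if both summands
  are.\<close>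

lemma ray_orbit_point:
  fixes N :: "(real ^ 'n) set" and v :: "real ^ 'n"
  defines "\<rho> \<equiv> convex_cone hull {v}"
  assumes t: "t \<in> torus N"
  defines "p \<equiv> (\<lambda>m\<in>cone_semigroup N \<rho>. t m * distinguished_point N \<rho> m)"
  shows "p \<in> affine_points N \<rho>" and "vanishing N v \<rho> p"
proof -
  have p: "p m = (if m \<bullet> v = 0 then t m else 0)" if "m \<in> cone_semigroup N \<rho>" for m
    using that ray_orthogonal[of v m] unfolding p_def \<rho>_def distinguished_point_def by simp
  have tm: "t (m + m') = t m * t m'" if "m \<in> cone_semigroup N \<rho>" "m' \<in> cone_semigroup N \<rho>" for m m'
    using t that unfolding torus_def cone_semigroup_def by blast
  \<comment> \<open>Together these give \<open>t 0 = 1\<close>.\<close>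
  have "t 0 \<noteq> 0" "t (0 + 0) = t 0 * t 0"
    using t dual_lattice_0 unfolding torus_def by blast+
  then have "p 0 = 1" using p[OF cone_semigroup_0] by simp
  moreover have "p (m + m') = p m * p m'"
    if m: "m \<in> cone_semigroup N \<rho>" "m' \<in> cone_semigroup N \<rho>" for m m'
  proof -
    have "0 \<le> m \<bullet> v" "0 \<le> m' \<bullet> v"
      using m cone_pairing_nonneg ray_mem unfolding \<rho>_def by blast+
    then have "(m + m') \<bullet> v = 0 \<longleftrightarrow> m \<bullet> v = 0 \<and> m' \<bullet> v = 0"
      by (simp add: inner_add_left add_nonneg_eq_0_iff)
    then show ?thesis
      using p[OF m(1)] p[OF m(2)] p[OF cone_semigroup_add[OF m]] tm[OF m] by auto
  qed
  ultimately show "p \<in> affine_points N \<rho>" by (simp add: affine_points_def p_def)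
  show "vanishing N v \<rho> p" using p ray_mem unfolding vanishing_def \<rho>_def by auto
qed

text \<open>A product of one-parameter subgroups of lattice vectors \<open>b\<close>, evaluated at
  prescribed nonzero parameters \<open>c b\<close>.\<close>

lemma character_product_in_torus:
  fixes A :: "(real ^ 'n) set" and c :: "real ^ 'n \<Rightarrow> complex"
  assumes "A \<subseteq> N" "\<And>b. b \<in> A \<Longrightarrow> c b \<noteq> 0" "finite A"
  shows "(\<lambda>m\<in>dual_lattice N. \<Prod>b\<in>A. c b powi \<lfloor>m \<bullet> b\<rfloor>) \<in> torus N"
proof -
  have "\<lfloor>(m + m') \<bullet> b\<rfloor> = \<lfloor>m \<bullet> b\<rfloor> + \<lfloor>m' \<bullet> b\<rfloor>" if "m \<in> dual_lattice N" "m' \<in> dual_lattice N" "b \<in> A" for m m' b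
  proof -
    have "m \<bullet> b \<in> \<int>" using that assms(1) unfolding dual_lattice_def by blast
    then show ?thesis by (auto simp: inner_add_left elim!: Ints_cases)
  qed
  then have "(\<Prod>b\<in>A. c b powi \<lfloor>(m + m') \<bullet> b\<rfloor>) = (\<Prod>b\<in>A. c b powi \<lfloor>m \<bullet> b\<rfloor>) * (\<Prod>b\<in>A. c b powi \<lfloor>m' \<bullet> b\<rfloor>)"
    if "m \<in> dual_lattice N" "m' \<in> dual_lattice N" for m m'
    using that assms(2) unfolding prod.distrib[symmetric] by (intro prod.cong) (auto simp: power_int_add)
  then show ?thesis
    using assms(2,3) by (auto simp: torus_def dual_lattice_add)
qed

text \<open>The chart of a full-dimensional smooth cone is an affine space with coordinates
  \<open>\<gamma> (d b)\<close>. In it the divisor is the hyperplane where the coordinate of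
  \<open>v\<close> is 0, and the orbit is its part where all other coordinates are nonzero.\<close>

lemma (in smooth_toric_fan) ray_divisor_in_closure:
  assumes \<eta>: "\<eta> \<in> \<Xi>" "lattice_basis N B" "\<eta> = convex_cone hull B" "span B = UNIV"
    and v: "v \<in> B" and \<rho>: "\<rho> = convex_cone hull {v}" "cone_face \<rho> \<eta>"
    and \<gamma>: "\<gamma> \<in> affine_points N \<eta>" "vanishing N v \<eta> \<gamma>"
  shows "toric_point N \<eta> \<gamma> \<in> toric_variety N \<Xi> closure_of torus_orbit N \<rho>"
proof -
  have indep: "independent B" and finB: "finite B"
    using \<eta>(2) lattice_basis_finite unfolding lattice_basis_def by blast+
  have BN: "B \<subseteq> N" by (rule lattice_basis_subset[OF \<eta>(2)])
  have B\<eta>: "b \<in> \<eta>" if "b \<in> B" for b using that \<eta>(3) by (simp add: hull_inc)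
  obtain d where d: "\<And>b b'. b \<in> B \<Longrightarrow> b' \<in> B \<Longrightarrow> d b \<bullet> b' = (if b = b' then 1 else 0)"
    using dual_basis_exists[OF indep] by metis
  have d\<eta>: "d b \<in> cone_semigroup N \<eta>" if "b \<in> B" for b
  proof -
    have "d b \<in> dual_lattice N"
      using lattice_basis_coeff[OF \<eta>(2) _ that d[OF that]] unfolding dual_lattice_def by blast
    moreover have "\<eta> \<subseteq> {x. d b \<bullet> x \<ge> 0}"
      unfolding \<eta>(3) using d[OF that] by (intro hull_minimal convex_cone_halfspace_ge) auto
    ultimately show ?thesis unfolding cone_semigroup_def dual_cone_def by blast
  qed
  have pair: "real (nat \<lfloor>m \<bullet> b\<rfloor>) = m \<bullet> b" if "m \<in> cone_semigroup N \<eta>" "b \<in> B" for m b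
    using cone_pairing_nat[OF that(1) B\<eta>[OF that(2)]] BN that(2) by blast
  \<comment> \<open>Characters are monomials in the coordinates. The difference of the two sides is
    orthogonal to \<open>B\<close>, which spans, so it is orthogonal to itself.\<close>
  have expand: "m = (\<Sum>b\<in>B. of_nat (nat \<lfloor>m \<bullet> b\<rfloor>) *\<^sub>R d b)" if m: "m \<in> cone_semigroup N \<eta>" for m
  proof -
    define m' where "m' = (\<Sum>b\<in>B. of_nat (nat \<lfloor>m \<bullet> b\<rfloor>) *\<^sub>R d b)"
    have "(m - m') \<bullet> b = 0" if "b \<in> B" for b
    proof -
      have "m' \<bullet> b = (\<Sum>b'\<in>B. if b' = b then m \<bullet> b else 0)"
        unfolding m'_def inner_sum_left using that d pair[OF m] by (intro sum.cong) auto
      then show ?thesis using that finB by (simp add: inner_diff_left)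
    qed
    moreover have "m - m' \<in> span B" using \<eta>(4) by simp
    ultimately have "m - m' = 0"
      using orthogonal_to_span[of "m - m'" B "m - m'"] by (simp add: orthogonal_def)
    then show ?thesis unfolding m'_def by simp
  qed
  \<comment> \<open>The curve \<open>\<Gamma>\<close> moves the zero coordinates of \<open>\<gamma>\<close> other than that of \<open>v\<close> to \<open>\<epsilon>\<close>.\<close>
  define c where "c \<epsilon> b = (if \<gamma> (d b) \<noteq> 0 \<or> b = v then \<gamma> (d b) else complex_of_real \<epsilon>)" for \<epsilon> b
  define \<Gamma> where "\<Gamma> \<epsilon> = (\<lambda>m\<in>cone_semigroup N \<eta>. \<Prod>b\<in>B. c \<epsilon> b ^ nat \<lfloor>m \<bullet> b\<rfloor>)" for \<epsilon>
  have cv: "c \<epsilon> v = 0" for \<epsilon>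
    using \<gamma>(2) d\<eta>[OF v] d[OF v v] unfolding c_def vanishing_def by simp
  have \<Gamma>_in: "\<Gamma> \<epsilon> \<in> affine_points N \<eta>" for \<epsilon>
    using cone_pairing_nat_add[OF _ _ B\<eta>] BN
    by (auto simp: affine_points_def \<Gamma>_def cone_semigroup_0 cone_semigroup_add
        prod.distrib[symmetric] power_add subset_iff intro!: prod.cong)
  \<comment> \<open>At parameter 0 the moved coordinates return to their original value 0.\<close>
  have \<Gamma>0: "\<Gamma> 0 = \<gamma>"
  proof (rule extensionalityI[OF affine_points_extensional[OF \<Gamma>_in] affine_points_extensional[OF \<gamma>(1)]])
    fix m assume m: "m \<in> cone_semigroup N \<eta>"
    have "\<gamma> m = \<gamma> (\<Sum>b\<in>B. of_nat (nat \<lfloor>m \<bullet> b\<rfloor>) *\<^sub>R d b)" using expand[OF m] by simp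
    also have "\<dots> = (\<Prod>b\<in>B. \<gamma> (of_nat (nat \<lfloor>m \<bullet> b\<rfloor>) *\<^sub>R d b))"
      using affine_points_sum[OF \<gamma>(1), of B "\<lambda>b. of_nat (nat \<lfloor>m \<bullet> b\<rfloor>) *\<^sub>R d b"] d\<eta>
      by (simp add: cone_semigroup_scaleR)
    also have "\<dots> = (\<Prod>b\<in>B. c 0 b ^ nat \<lfloor>m \<bullet> b\<rfloor>)"
      using affine_points_power[OF \<gamma>(1) d\<eta>] by (intro prod.cong) (auto simp: c_def)
    finally show "\<Gamma> 0 m = \<gamma> m" using m by (simp add: \<Gamma>_def)
  qed
  have \<Gamma>_cont: "continuous_map euclidean (affine_classical N \<eta>) \<Gamma>"
    unfolding continuous_map_affine_classical
  proof (intro conjI ballI)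
    show "\<Gamma> ` topspace euclidean \<subseteq> affine_points N \<eta>" using \<Gamma>_in by blast
    fix m assume m: "m \<in> cone_semigroup N \<eta>"
    have "continuous_on UNIV (\<lambda>\<epsilon>. c \<epsilon> b)" for b
      unfolding c_def by (cases "\<gamma> (d b) \<noteq> 0 \<or> b = v") (auto intro!: continuous_intros)
    then have "continuous_on UNIV (\<lambda>\<epsilon>. \<Prod>b\<in>B. c \<epsilon> b ^ nat \<lfloor>m \<bullet> b\<rfloor>)"
      by (intro continuous_intros)
    then show "continuous_map euclidean euclidean (\<lambda>\<epsilon>. \<Gamma> \<epsilon> m)" using m by (simp add: \<Gamma>_def)
  qed
  have orbit: "toric_point N \<eta> (\<Gamma> \<epsilon>) \<in> torus_orbit N \<rho>" if "\<epsilon> \<noteq> 0" for \<epsilon>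
  proof -
    \<comment> \<open>The coordinate of \<open>v\<close> is left out because it is 0; the remaining
      ones are nonzero for \<open>\<epsilon> \<noteq> 0\<close>, so they define a torus
      element.\<close>
    define t where "t = (\<lambda>m\<in>dual_lattice N. \<Prod>b\<in>B - {v}. c \<epsilon> b powi \<lfloor>m \<bullet> b\<rfloor>)"
    have t: "t \<in> torus N"
      unfolding t_def using BN that finB by (intro character_product_in_torus) (auto simp: c_def)
    define p where "p = (\<lambda>m\<in>cone_semigroup N \<rho>. t m * distinguished_point N \<rho> m)"
    have p: "p \<in> affine_points N \<rho>" "vanishing N v \<rho> p"
      using ray_orbit_point[OF t, of v] unfolding p_def \<rho>(1) by auto
    have sub: "cone_semigroup N \<eta> \<subseteq> cone_semigroup N \<rho>"
      by (rule cone_semigroup_antimono[OF cone_face_subset[OF \<rho>(2)]])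
    have "restrict p (cone_semigroup N \<eta>) = \<Gamma> \<epsilon>"
    proof (rule extensionalityI[OF restrict_extensional affine_points_extensional[OF \<Gamma>_in]])
      fix m assume m: "m \<in> cone_semigroup N \<eta>"
      have split: "\<Gamma> \<epsilon> m = c \<epsilon> v ^ nat \<lfloor>m \<bullet> v\<rfloor> * (\<Prod>b\<in>B - {v}. c \<epsilon> b ^ nat \<lfloor>m \<bullet> b\<rfloor>)"
        using m finB v by (simp add: \<Gamma>_def prod.remove)
      have "p m = \<Gamma> \<epsilon> m"
      proof (cases "m \<bullet> v = 0")
        case True
        have "p m = t m"
          using m sub True ray_orthogonal[of v m] unfolding p_def distinguished_point_def \<rho>(1) by auto
        also have "\<dots> = (\<Prod>b\<in>B - {v}. c \<epsilon> b ^ nat \<lfloor>m \<bullet> b\<rfloor>)"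
        proof -
          have "c \<epsilon> b powi \<lfloor>m \<bullet> b\<rfloor> = c \<epsilon> b ^ nat \<lfloor>m \<bullet> b\<rfloor>" if "b \<in> B" for b
            using cone_pairing_nonneg[OF m B\<eta>[OF that]] by (simp add: power_int_def)
          then show ?thesis using m unfolding t_def cone_semigroup_def by simp
        qed
        finally show ?thesis using split True by simp
      next
        case False
        then have "nat \<lfloor>m \<bullet> v\<rfloor> \<noteq> 0" using pair[OF m v] by (metis of_nat_0)
        then have "\<Gamma> \<epsilon> m = 0" using split cv by simp
        moreover have "p m = 0" using p(2) False m sub unfolding vanishing_def by blast
        ultimately show ?thesis by simp
      qed
      then show "restrict p (cone_semigroup N \<eta>) m = \<Gamma> \<epsilon> m" using m by simp
    qed
    then have "toric_point N \<eta> (\<Gamma> \<epsilon>) = toric_point N \<rho> p"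
      using toric_point_face[OF \<eta>(1) \<rho>(2) p(1)] by simp
    then show ?thesis using t unfolding torus_orbit_def p_def by blast
  qed
  show ?thesis
    unfolding in_closure_of topspace_toric_variety
  proof (intro conjI allI impI)
    show "toric_point N \<eta> \<gamma> \<in> toric_points N \<Xi>"
      using \<eta>(1) \<gamma>(1) unfolding toric_points_def by blast
    fix W assume W: "toric_point N \<eta> \<gamma> \<in> W \<and> openin (toric_variety N \<Xi>) W"
    then have "openin (affine_classical N \<eta>) {\<gamma> \<in> affine_points N \<eta>. toric_point N \<eta> \<gamma> \<in> W}"
      using \<eta>(1) unfolding toric_variety_def openin_glued_topology by blast
    from openin_continuous_map_preimage[OF \<Gamma>_cont this]
    have "open {\<epsilon>. toric_point N \<eta> (\<Gamma> \<epsilon>) \<in> W}" using \<Gamma>_in by simp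
    moreover have "0 \<in> {\<epsilon>. toric_point N \<eta> (\<Gamma> \<epsilon>) \<in> W}" using \<Gamma>0 W by simp
    ultimately obtain e where e: "e > 0" "ball 0 e \<subseteq> {\<epsilon>. toric_point N \<eta> (\<Gamma> \<epsilon>) \<in> W}"
      by (meson open_contains_ball)
    \<comment> \<open>Any nonzero parameter in the ball would do: its point of the curve lies in the
      orbit.\<close>
    then have "e / 2 \<in> ball 0 e" by simp
    then have "toric_point N \<eta> (\<Gamma> (e / 2)) \<in> W" using e(2) by blast
    moreover have "toric_point N \<eta> (\<Gamma> (e / 2)) \<in> torus_orbit N \<rho>" using orbit e(1) by simp
    ultimately show "\<exists>y. y \<in> torus_orbit N \<rho> \<and> y \<in> W" by blast
  qed
qed

text \<open>The sum of the dual vectors of the other generators is nonnegative on the cone and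
  vanishes exactly on the ray of \<open>v\<close>.\<close>

lemma smooth_ray_face:
  assumes B: "lattice_basis N B" "S \<subseteq> B" and v: "v \<in> S"
  shows "cone_face (convex_cone hull {v}) (convex_cone hull S)"
proof -
  have finS: "finite S" using lattice_basis_finite[OF B(1)] B(2) finite_subset by blast
  obtain d where d: "\<And>b b'. b \<in> B \<Longrightarrow> b' \<in> B \<Longrightarrow> d b \<bullet> b' = (if b = b' then 1 else 0)"
    using dual_basis_exists B(1) unfolding lattice_basis_def by metis
  define m where "m = (\<Sum>b\<in>S - {v}. d b)"
  have m_dot: "m \<bullet> b = (if b = v then 0 else 1)" if "b \<in> S" for b
  proof -
    have "m \<bullet> b = (\<Sum>b'\<in>S - {v}. if b' = b then 1 else 0)"
      unfolding m_def inner_sum_left using that B(2) by (intro sum.cong) (auto simp: d subset_iff)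
    then show ?thesis using that finS by simp
  qed
  have nonneg: "0 \<le> m \<bullet> x" if "x \<in> convex_cone hull S" for x
  proof -
    have "convex_cone hull S \<subseteq> {x. m \<bullet> x \<ge> 0}"
      using m_dot by (intro hull_minimal convex_cone_halfspace_ge) auto
    then show ?thesis using that by blast
  qed
  have "convex_cone hull S \<inter> {x. m \<bullet> x = 0} = convex_cone hull {v}"
  proof
    show "convex_cone hull {v} \<subseteq> convex_cone hull S \<inter> {x. m \<bullet> x = 0}"
      using hull_mono[of "{v}" S convex_cone] v m_dot[OF v] by (auto simp: ray_eq)
    show "convex_cone hull S \<inter> {x. m \<bullet> x = 0} \<subseteq> convex_cone hull {v}"
    proof
      fix x assume x: "x \<in> convex_cone hull S \<inter> {x. m \<bullet> x = 0}"
      then obtain c where c: "x = (\<Sum>b\<in>S. c b *\<^sub>R b)" "\<forall>b\<in>S. 0 \<le> c b"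
        unfolding convex_cone_hull_finite[OF finS] by blast
      have "(\<Sum>b\<in>S. c b * (if b = v then 0 else 1)) = 0"
        using x unfolding c(1) by (simp add: inner_sum_right m_dot)
      then have "\<forall>b\<in>S. c b * (if b = v then 0 else 1) = 0"
        using c(2) by (subst (asm) sum_nonneg_eq_0_iff[OF finS]) auto
      then have "x = (\<Sum>b\<in>S. if b = v then c v *\<^sub>R v else 0)"
        unfolding c(1) by (intro sum.cong) auto
      then have "x = c v *\<^sub>R v" using finS v by simp
      then show "x \<in> convex_cone hull {v}" using c(2) v by (auto simp: ray_eq)
    qed
  qed
  moreover have "(convex_cone hull S \<inter> {x. m \<bullet> x = 0}) face_of convex_cone hull S"
    using nonneg by (intro face_of_Int_supporting_hyperplane_ge convex_convex_cone_hull) auto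
  ultimately show ?thesis
    unfolding cone_face_def using convex_cone_hull_nonempty by auto
qed

text \<open>Some coefficient of \<open>v\<close> is nonzero; as a nonnegative integer it is at least
  1, so the generator \<open>b\<close> can be subtracted without leaving the cone or the lattice.
  Irreducibility of \<open>v = b + (v - b)\<close> leaves only \<open>v = b\<close>.\<close>

lemma Hilbert_basis_in_generators:
  assumes v: "v \<in> Hilbert_basis (\<sigma> \<inter> N)" and B: "lattice_basis N B" "S \<subseteq> B"
    and S: "convex_cone hull S \<subseteq> \<sigma>" "v \<in> convex_cone hull S"
  shows "v \<in> S"
proof -
  have finS: "finite S" using lattice_basis_finite[OF B(1)] B(2) finite_subset by blast
  have indep: "independent B" using B(1) unfolding lattice_basis_def by blast
  have vN: "v \<in> N" and v0: "v \<noteq> 0" using v unfolding Hilbert_basis_def by auto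
  obtain d where d: "\<And>b b'. b \<in> B \<Longrightarrow> b' \<in> B \<Longrightarrow> d b \<bullet> b' = (if b = b' then 1 else 0)"
    using dual_basis_exists[OF indep] by metis
  obtain c where c: "v = (\<Sum>b\<in>S. c b *\<^sub>R b)" "\<forall>b\<in>S. 0 \<le> c b"
    using S(2) unfolding convex_cone_hull_finite[OF finS] by blast
  have "\<exists>b\<in>S. c b \<noteq> 0"
  proof (rule ccontr)
    assume "\<not> (\<exists>b\<in>S. c b \<noteq> 0)"
    then have "v = 0" unfolding c(1) by simp
    with v0 show False ..
  qed
  then obtain b where b: "b \<in> S" "c b \<noteq> 0" by blast
  have bB: "b \<in> B" using b(1) B(2) by blast
  have "d b \<bullet> v = (\<Sum>b'\<in>S. if b' = b then c b else 0)"
    unfolding c(1) inner_sum_right using d[OF bB] B(2) by (intro sum.cong) (auto simp: subset_iff)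
  then have "c b = d b \<bullet> v" using finS b(1) by simp
  then have "c b \<in> \<int>" using lattice_basis_coeff[OF B(1) vN bB d[OF bB]] by simp
  then obtain k :: int where "c b = of_int k" by (elim Ints_cases)
  moreover have "0 \<le> c b" using b(1) c(2) by blast
  ultimately have c1: "1 \<le> c b" using b(2) by simp
  have "v - b = (\<Sum>b'\<in>S. (c b' - (if b' = b then 1 else 0)) *\<^sub>R b')"
    using finS b(1) unfolding c(1)
    by (simp add: scaleR_left_diff_distrib sum_subtractf if_distrib[where f = "\<lambda>r. r *\<^sub>R _"] cong: if_cong)
  then have "v - b \<in> convex_cone hull S"
    unfolding convex_cone_hull_finite[OF finS] using c(2) c1
    by (intro CollectI exI[of _ "\<lambda>b'. c b' - (if b' = b then 1 else 0)"]) auto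
  moreover have "v - b \<in> N"
  proof -
    obtain k :: "_ \<Rightarrow> int" where "v = (\<Sum>b\<in>B. of_int (k b) *\<^sub>R b)"
      using vN B(1) unfolding lattice_basis_def by auto
    moreover obtain l :: "_ \<Rightarrow> int" where "b = (\<Sum>b\<in>B. of_int (l b) *\<^sub>R b)"
      using lattice_basis_subset[OF B(1)] bB B(1) unfolding lattice_basis_def by auto
    ultimately have "v - b = (\<Sum>b\<in>B. of_int (k b - l b) *\<^sub>R b)"
      by (simp add: scaleR_left_diff_distrib sum_subtractf)
    then have "v - b \<in> {\<Sum>b\<in>B. of_int (c b) *\<^sub>R b | c :: real ^ _ \<Rightarrow> int. True}"
      by (intro CollectI exI conjI TrueI)
    then show ?thesis using B(1) unfolding lattice_basis_def by simp
  qed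
  moreover have "b \<in> \<sigma> \<inter> N"
    using S(1) b(1) lattice_basis_subset[OF B(1)] bB hull_inc[of b S convex_cone] by blast
  moreover have "v = b + (v - b)" by simp
  ultimately have "b = 0 \<or> v - b = 0"
    using v S(1) unfolding Hilbert_basis_def by blast
  moreover have "b \<noteq> 0" using indep bB dependent_zero by blast
  ultimately show ?thesis using b(1) by simp
qed

lemma (in smooth_toric_fan) star_of_ray:
  fixes v :: "real ^ 'n"
  defines "\<rho> \<equiv> convex_cone hull {v}"
  assumes conv: "convex (\<Union>\<Xi>)" and int: "interior (\<Union>\<Xi>) \<noteq> {}"
    and v: "v \<in> Hilbert_basis (\<Union>\<Xi> \<inter> N)"
  shows "deformation_retract_of (orbit_closure N \<Xi> \<rho>) (toric_variety N (star_fan \<Xi> \<rho>)) \<and>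
         openin (toric_Zariski N \<Xi>) (toric_points N (star_fan \<Xi> \<rho>)) \<and>
         openin (toric_variety N \<Xi>) (toric_points N (star_fan \<Xi> \<rho>))"
proof -
  have vN: "v \<in> N" and v\<Xi>: "v \<in> \<Union>\<Xi>" using v unfolding Hilbert_basis_def by auto
  have gen: "v \<in> S" if "\<eta> \<in> \<Xi>" "v \<in> \<eta>" "lattice_basis N B" "S \<subseteq> B" "\<eta> = convex_cone hull S" for \<eta> B S
    using Hilbert_basis_in_generators[OF v that(3,4)] that(1,2,5) by blast
  have \<rho>_face: "cone_face \<rho> \<eta>" if \<eta>: "\<eta> \<in> \<Xi>" "v \<in> \<eta>" for \<eta>
  proof -
    obtain B S where B: "lattice_basis N B" "S \<subseteq> B" "\<eta> = convex_cone hull S"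
      using smooth_cone[OF \<eta>(1)] .
    show ?thesis using smooth_ray_face[OF B(1,2) gen[OF \<eta> B]] unfolding B(3) \<rho>_def .
  qed
  have v\<rho>: "v \<in> \<rho>" unfolding \<rho>_def by (rule ray_mem)
  obtain \<tau>0 where "\<tau>0 \<in> \<Xi>" "v \<in> \<tau>0" using v\<Xi> by blast
  then have \<rho>: "\<rho> \<in> \<Xi>" using face_mem \<rho>_face by blast
  define \<Psi> where "\<Psi> = star_fan \<Xi> \<rho>"
  \<comment> \<open>The star is from here on described by membership of \<open>v\<close>, the form
    needed by the contraction.\<close>
  have \<rho>_iff: "cone_face \<rho> \<eta> \<longleftrightarrow> v \<in> \<eta>" if "\<eta> \<in> \<Xi>" for \<eta>
    using \<rho>_face[OF that] cone_face_subset[of \<rho> \<eta>] v\<rho> by blast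
  have mem: "\<tau> \<in> \<Psi> \<longleftrightarrow> (\<exists>\<eta>\<in>\<Xi>. dim \<eta> = CARD('n) \<and> v \<in> \<eta> \<and> cone_face \<tau> \<eta>)" for \<tau>
    unfolding \<Psi>_def star_fan_def cones_of_dim_def using \<rho>_iff by auto
  have \<Psi>1: "\<Psi> \<subseteq> \<Xi>" using mem face_mem by blast
  have \<Psi>2: "\<forall>\<eta>\<in>\<Psi>. \<forall>\<kappa>. cone_face \<kappa> \<eta> \<longrightarrow> \<kappa> \<in> \<Psi>"
  proof (intro ballI allI impI)
    fix \<tau> \<kappa> assume "\<tau> \<in> \<Psi>" and \<kappa>: "cone_face \<kappa> \<tau>"
    then obtain \<eta> where "\<eta> \<in> \<Xi>" "dim \<eta> = CARD('n)" "v \<in> \<eta>" "cone_face \<tau> \<eta>" using mem by auto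
    then show "\<kappa> \<in> \<Psi>" using cone_face_trans[OF \<kappa>, of \<eta>] mem by auto
  qed
  have \<Psi>3: "\<forall>\<tau>\<in>\<Psi>. \<exists>\<eta>\<in>\<Psi>. v \<in> \<eta> \<and> cone_face \<tau> \<eta>"
  proof
    fix \<tau> assume "\<tau> \<in> \<Psi>"
    then obtain \<eta> where \<eta>: "\<eta> \<in> \<Xi>" "dim \<eta> = CARD('n)" "v \<in> \<eta>" "cone_face \<tau> \<eta>" using mem by auto
    then have "\<eta> \<in> \<Psi>" using rational_cone_face_refl[OF rational[OF \<eta>(1)]] mem by auto
    then show "\<exists>\<eta>\<in>\<Psi>. v \<in> \<eta> \<and> cone_face \<tau> \<eta>" using \<eta>(3,4) by auto
  qed
  have maximal: "\<exists>\<eta>\<in>\<Xi>. dim \<eta> = CARD('n) \<and> v \<in> \<eta> \<and> cone_face \<tau> \<eta>" if \<tau>: "\<tau> \<in> \<Xi>" "v \<in> \<tau>" for \<tau>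
  proof -
    obtain \<eta> where "\<eta> \<in> \<Xi>" "dim \<eta> = CARD('n)" "cone_face \<tau> \<eta>"
      using in_full_dim_cone[OF conv int \<tau>(1)] by auto
    then show ?thesis using cone_face_subset[of \<tau> \<eta>] \<tau>(2) by auto
  qed
  have sub: "ray_divisor N \<Xi> v \<subseteq> toric_points N \<Psi>"
  proof
    fix x assume "x \<in> ray_divisor N \<Xi> v"
    then obtain \<tau> \<gamma> where x: "\<tau> \<in> \<Xi>" "\<gamma> \<in> affine_points N \<tau>" "v \<in> \<tau>" "x = toric_point N \<tau> \<gamma>"
      unfolding ray_divisor_def vanishing_def by blast
    then have "\<tau> \<in> \<Psi>" using mem maximal by auto
    then show "x \<in> toric_points N \<Psi>" using x unfolding toric_points_def by blast
  qed
  have "orbit_closure N \<Xi> \<rho> = ray_divisor N \<Xi> v"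
  proof
    have "torus_orbit N \<rho> \<subseteq> ray_divisor N \<Xi> v"
    proof
      fix x assume "x \<in> torus_orbit N \<rho>"
      then obtain t where t: "t \<in> torus N"
        "x = toric_point N \<rho> (\<lambda>m\<in>cone_semigroup N \<rho>. t m * distinguished_point N \<rho> m)"
        unfolding torus_orbit_def by blast
      show "x \<in> ray_divisor N \<Xi> v"
        unfolding t(2) using ray_orbit_point[OF t(1), of v] \<rho> ray_divisor_iff[OF \<rho>] unfolding \<rho>_def by simp
    qed
    then show "orbit_closure N \<Xi> \<rho> \<subseteq> ray_divisor N \<Xi> v"
      unfolding orbit_closure_def by (rule closure_of_minimal[OF _ closedin_ray_divisor])
    show "ray_divisor N \<Xi> v \<subseteq> orbit_closure N \<Xi> \<rho>"
    proof
      fix x assume "x \<in> ray_divisor N \<Xi> v"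
      then obtain \<tau> \<gamma> where x: "\<tau> \<in> \<Xi>" "\<gamma> \<in> affine_points N \<tau>" "vanishing N v \<tau> \<gamma>" "x = toric_point N \<tau> \<gamma>"
        unfolding ray_divisor_def by blast
      \<comment> \<open>By purity the representative can be moved to a full-dimensional cone, whose
        chart is an affine space.\<close>
      then obtain \<eta> where \<eta>: "\<eta> \<in> \<Xi>" "dim \<eta> = CARD('n)" "v \<in> \<eta>" "cone_face \<tau> \<eta>"
        using maximal unfolding vanishing_def by auto
      obtain B where B: "lattice_basis N B" "\<eta> = convex_cone hull B" "span B = UNIV"
        using full_dim_smooth_cone[OF \<eta>(1,2)] .
      note face = cone_face_subset[OF \<eta>(4)]
      show "x \<in> orbit_closure N \<Xi> \<rho>"
        unfolding x(4) toric_point_face[OF \<eta>(1,4) x(2)] orbit_closure_def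
        using ray_divisor_in_closure[OF \<eta>(1) B gen[OF \<eta>(1,3) B(1) _ B(2)] \<rho>_def[THEN meta_eq_to_obj_eq] \<rho>_face[OF \<eta>(1,3)]
            affine_points_restrict[OF face x(2)] vanishing_restrict[OF x(3) face]] by simp
    qed
  qed
  then show ?thesis
    using deformation_retract_ray_divisor[OF vN \<Psi>1 \<Psi>3 sub] subfan_open[OF \<Psi>1 \<Psi>2]
    unfolding \<Psi>_def by simp
qed

section \<open>Convexity and interior of the positive orthant\<close>

lemma convex_standard_cone: "convex standard_cone"
  unfolding standard_cone_def by (rule convex_convex_cone_hull)

lemma interior_standard_cone: "interior (standard_cone :: (real ^ 'n) set) \<noteq> {}"
proof -
  have "box 0 1 \<subseteq> (standard_cone :: (real ^ 'n) set)"
  proof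
    fix x :: "real ^ 'n" assume "x \<in> box 0 1"
    then have pos: "0 < x $ i" for i by (simp add: mem_box_cart)
    have "(\<Sum>i\<in>A. x $ i *\<^sub>R axis i 1) \<in> standard_cone" if "finite A" for A
      using that unfolding standard_cone_def
    proof (induction A)
      case (insert i A)
      have "x $ i *\<^sub>R axis i 1 \<in> convex_cone hull range (\<lambda>i. axis i (1 :: real))"
        using pos[of i] by (intro convex_cone_hull_mul hull_inc) auto
      with insert show ?case by (simp add: convex_cone_hull_add)
    qed (simp add: convex_cone_hull_contains_0)
    then have "(\<Sum>i\<in>UNIV. x $ i *\<^sub>R axis i 1) \<in> standard_cone" by simp
    moreover have "(\<Sum>i\<in>UNIV. x $ i *\<^sub>R axis i 1) = x"
      using basis_expansion[of x] by (simp add: scalar_mult_eq_scaleR)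
    ultimately show "x \<in> standard_cone" by simp
  qed
  then have "box 0 1 \<subseteq> interior (standard_cone :: (real ^ 'n) set)"
    by (rule interior_maximal[OF _ open_box])
  moreover have "(\<chi> i. 1 / 2) \<in> box 0 (1 :: real ^ 'n)" by (simp add: mem_box_cart)
  ultimately show ?thesis by blast
qed

theorem theorem3p5:
  fixes G :: "(complex ^ 'n ^ 'n) set" and \<epsilon> :: complex
    and \<Xi> :: "(real ^ 'n) set set" and g :: "complex ^ 'n ^ 'n"
  defines "N \<equiv> quotient_lattice \<epsilon> G"
    and "\<rho> \<equiv> convex_cone hull {frac_expr (card G) \<epsilon> g}"
  assumes "finite G" and "subgroup G SL_group" and "comm_group (SL_group\<lparr>carrier := G\<rparr>)"
    and "\<forall>A\<in>G. diagonal_matrix A"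
    and "primitive_root_of_unity (card G) \<epsilon>"
    and "Hilbert_basis_resolution N standard_cone \<Xi>"
    and "g \<in> G" and "frac_expr (card G) \<epsilon> g \<in> Hilbert_basis (standard_cone \<inter> N)"
    and "age (frac_expr (card G) \<epsilon> g) = 1"
  shows "deformation_retract_of (orbit_closure N \<Xi> \<rho>) (toric_variety N (star_fan \<Xi> \<rho>)) \<and>
         openin (toric_Zariski N \<Xi>) (toric_points N (star_fan \<Xi> \<rho>)) \<and>
         openin (toric_variety N \<Xi>) (toric_points N (star_fan \<Xi> \<rho>))"
proof -
  have \<Xi>: "smooth_fan N \<Xi>" "\<Union>\<Xi> = standard_cone"
    using assms unfolding Hilbert_basis_resolution_def by auto
  interpret smooth_toric_fan N \<Xi> by unfold_locales (rule \<Xi>(1))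
  show ?thesis
    unfolding \<rho>_def
    using assms(10) by (intro star_of_ray) (simp_all add: \<Xi>(2) convex_standard_cone interior_standard_cone)
qed

end
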